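(* Let $q\ge 3$ be a prime power and let $X\subset\mathbb{P}^3(\mathbb{F}_q)$ be an elliptic quadric. The code $C_2(X)$ is an $[n,k,d]_q$-code with $$n=q^2+1,\qquad k=9,\qquad d=q^2-2q-1.$$
   Context: A quadric in $\mathbb{P}^3(\mathbb{F}_q)$ is the zero set $Z(f)$ of a nonzero form $f$ of degree 2 in $x_0,\dots,x_3$ over $\mathbb{F}_q$. It is non-degenerate if it has rank 4, the rank being the smallest number of indeterminates appearing in $f$ under any linear change of coordinates. An elliptic quadric is a non-degenerate quadric with $q^2+1$ points over $\mathbb{F}_q$. Let $F$ be the $\mathbb{F}_q$-vector space of forms of degree 2 in $x_0,\dots,x_3$ over $\mathbb{F}_q$ (including $0$). Each point $x\in\mathbb{P}^3(\mathbb{F}_q)$ is represented by its unique homogeneous coordinate vector whose first nonzero coordinate equals $1$. The functional code $C_2(X)$ is the image of the linear map $c:F\to\mathbb{F}_q^{|X|}$, $c(f)=(f(x_0,\dots,x_3))_{x\in X}$. An $[n,k,d]_q$-code is a linear code over $\mathbb{F}_q$ of length $n$, dimension $k$ and minimum distance $d$. *)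

theory Defs
  imports
    "HOL-Analysis.Analysis"
    "HOL-Library.Poly_Mapping"
    "HOL-Library.Function_Algebras"
begin

section \<open>Forms of degree 2 in four indeterminates\<close>

text \<open>
  Indeterminates are indexed by the four-element type \<^typ>\<open>4\<close>, with elements 0, 1, 2, 3 in
  this order (the numeral 4 of this type equals 0).  Polynomials are formal: finitely supported
  maps from exponent vectors to coefficients, with the library's convolution product.
\<close>

type_synonym 'a poly4 = "(4 \<Rightarrow>\<^sub>0 nat) \<Rightarrow>\<^sub>0 'a"

definition forms2 :: "'a::zero poly4 set" where
  "forms2 = {f. \<forall>m \<in> Poly_Mapping.keys f. (\<Sum>i\<in>UNIV. Poly_Mapping.lookup m i) = 2}"

definition eval_poly :: "'a::comm_semiring_1 poly4 \<Rightarrow> 'a ^ 4 \<Rightarrow> 'a" where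
  "eval_poly f x =
     (\<Sum>m\<in>Poly_Mapping.keys f. Poly_Mapping.lookup f m *
        (\<Prod>i\<in>UNIV. x $ i ^ Poly_Mapping.lookup m i))"

definition indets :: "'a::zero poly4 \<Rightarrow> 4 set" where
  "indets f = (\<Union>m\<in>Poly_Mapping.keys f. Poly_Mapping.keys m)"

definition const_poly :: "'a::zero \<Rightarrow> 'a poly4" where
  "const_poly c = Poly_Mapping.single 0 c"

definition indet :: "4 \<Rightarrow> 'a::zero_neq_one poly4" where
  "indet i = Poly_Mapping.single (Poly_Mapping.single i 1) 1"

text \<open>The polynomial \<open>f(A x)\<close>, i.e. \<open>x\<^sub>i\<close> is replaced by the sum of all \<open>A\<^sub>i\<^sub>j x\<^sub>j\<close>.\<close>

definition lin_subst :: "'a::comm_ring_1 ^ 4 ^ 4 \<Rightarrow> 'a poly4 \<Rightarrow> 'a poly4" where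
  "lin_subst A f =
     (\<Sum>m\<in>Poly_Mapping.keys f. const_poly (Poly_Mapping.lookup f m) *
        (\<Prod>i\<in>UNIV. (\<Sum>j\<in>UNIV. const_poly (A $ i $ j) * indet j) ^ Poly_Mapping.lookup m i))"

definition form_rank :: "'a::field poly4 \<Rightarrow> nat" where
  "form_rank f = Min {card (indets (lin_subst A f)) | A. invertible A}"


section \<open>Projective space and elliptic quadrics\<close>

text \<open>
  A point of the projective space is identified with its unique coordinate vector whose first
  nonzero coordinate is 1.
\<close>

definition proj_points :: "('a::field ^ 4) set" where
  "proj_points = {x. \<exists>i. x $ i = 1 \<and> (\<forall>j<i. x $ j = 0)}"

lemma proj_points_representatives:
  fixes v :: "'a::field ^ 4"
  assumes "v \<noteq> 0"
  shows "\<exists>!x. x \<in> proj_points \<and> (\<exists>c. c \<noteq> 0 \<and> x = c *s v)"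
proof -
  have ne: "\<exists>i. v $ i \<noteq> 0"
    using assms by (simp add: vec_eq_iff)
  define i where "i = (LEAST i. v $ i \<noteq> 0)"
  have vi: "v $ i \<noteq> 0"
    unfolding i_def using ne by (rule LeastI_ex)
  have vj: "v $ j = 0" if "j < i" for j
    using not_less_Least[of j "\<lambda>i. v $ i \<noteq> 0"] that unfolding i_def by blast
  have uniq: "x = inverse (v $ i) *s v"
    if x: "x \<in> proj_points" and c: "c \<noteq> 0" "x = c *s v" for x c
  proof -
    from x obtain k where k: "x $ k = 1" "\<forall>j<k. x $ j = 0"
      unfolding proj_points_def mem_Collect_eq by blast
    have xc: "x $ j = c * v $ j" for j
      unfolding c(2) by (rule vector_smult_component)
    have "\<not> k < i"
    proof
      assume "k < i"
      then have "v $ k = 0" by (rule vj)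
      then show False using k(1) xc[of k] by simp
    qed
    moreover have "\<not> i < k"
    proof
      assume "i < k"
      then have "x $ i = 0" using k(2) by blast
      then show False using vi c(1) xc[of i] by simp
    qed
    ultimately have "k = i" by (meson linorder_less_linear)
    then have "v $ i * c = 1"
      using k(1) xc[of k] by (metis mult.commute)
    then have "inverse (v $ i) = c"
      by (rule inverse_unique)
    then show ?thesis
      using c(2) by blast
  qed
  have "inverse (v $ i) *s v \<in> proj_points"
    unfolding proj_points_def mem_Collect_eq vector_smult_component
    using vi vj by (intro exI[of _ i]) simp
  moreover have "inverse (v $ i) \<noteq> 0"
    using vi by simp
  ultimately have "inverse (v $ i) *s v \<in> proj_points \<and>
      (\<exists>c. c \<noteq> 0 \<and> inverse (v $ i) *s v = c *s v)"
    by (intro conjI exI[of _ "inverse (v $ i)"] refl)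
  then show ?thesis
    by (rule ex1I) (elim conjE exE, rule uniq)
qed

definition zero_set :: "'a::field poly4 \<Rightarrow> ('a ^ 4) set" where
  "zero_set f = {x \<in> proj_points. eval_poly f x = 0}"

definition nondegenerate_quadric :: "('a::field ^ 4) set \<Rightarrow> bool" where
  "nondegenerate_quadric X \<longleftrightarrow>
     (\<exists>f \<in> forms2. f \<noteq> 0 \<and> form_rank f = 4 \<and> X = zero_set f)"

definition elliptic_quadric :: "('a::{field,finite} ^ 4) set \<Rightarrow> bool" where
  "elliptic_quadric X \<longleftrightarrow> nondegenerate_quadric X \<and> card X = CARD('a) ^ 2 + 1"


section \<open>Linear codes\<close>

text \<open>
  Words indexed by a finite set \<open>I\<close> are functions vanishing outside \<open>I\<close>, with pointwise
  operations.
\<close>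

definition scale_word :: "'a::field \<Rightarrow> ('i \<Rightarrow> 'a) \<Rightarrow> 'i \<Rightarrow> 'a" where
  "scale_word c w = (\<lambda>i. c * w i)"

global_interpretation word: vector_space scale_word
  by unfold_locales (simp_all add: scale_word_def fun_eq_iff distrib_left distrib_right mult.assoc)

definition words :: "'i set \<Rightarrow> ('i \<Rightarrow> 'a::field) set" where
  "words I = {w. \<forall>i. i \<notin> I \<longrightarrow> w i = 0}"

definition hamming_dist :: "'i set \<Rightarrow> ('i \<Rightarrow> 'a) \<Rightarrow> ('i \<Rightarrow> 'a) \<Rightarrow> nat" where
  "hamming_dist I u v = card {i \<in> I. u i \<noteq> v i}"

definition min_distance :: "'i set \<Rightarrow> ('i \<Rightarrow> 'a) set \<Rightarrow> nat" where
  "min_distance I C = Min {hamming_dist I u v | u v. u \<in> C \<and> v \<in> C \<and> u \<noteq> v}"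

definition is_linear_code ::
    "'i set \<Rightarrow> ('i \<Rightarrow> 'a::field) set \<Rightarrow> nat \<Rightarrow> nat \<Rightarrow> nat \<Rightarrow> bool" where
  "is_linear_code I C n k d \<longleftrightarrow>
     finite I \<and> C \<subseteq> words I \<and> word.subspace C \<and>
     card I = n \<and> word.dim C = k \<and> min_distance I C = d"

definition eval_word :: "('a::field ^ 4) set \<Rightarrow> 'a poly4 \<Rightarrow> 'a ^ 4 \<Rightarrow> 'a" where
  "eval_word X f = (\<lambda>x. if x \<in> X then eval_poly f x else 0)"

definition functional_code2 :: "('a::field ^ 4) set \<Rightarrow> ('a ^ 4 \<Rightarrow> 'a) set" where
  "functional_code2 X = eval_word X ` forms2"

end

theory Submission
  imports Defs
begin

text \<open>
  All counting is done in the affine space \<open>V = F\<^sub>q\<^sup>4\<close>, along parallel lines.  Let \<open>Q\<close> be the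
  form of the quadric; it has \<open>q\<^sup>3 - q\<^sup>2 + q\<close> zeros in \<open>V\<close>, and rank 4 means that no nonzero
  zero is singular.  Counting along the lines in the direction of a zero \<open>p\<close> shows that the
  tangent space at \<open>p\<close> contains only the zeros proportional to \<open>p\<close>, and then that \<open>Q\<close> has 1,
  \<open>q\<close> or \<open>q\<^sup>2\<close> zeros in every hyperplane of \<open>V\<close>.  A nonzero form of degree 2 either has at most
  \<open>q\<^sup>3 + q\<^sup>2\<close> zeros in \<open>V\<close> or is a product of two linear forms.  For a form \<open>h\<close> that is no
  multiple of \<open>Q\<close>, the first alternative for all members of the pencil \<open>h + c Q\<close>, or the second
  for one of them, gives at most \<open>2 q\<^sup>2 - 1\<close> common zeros of \<open>h\<close> and \<open>Q\<close>, that is,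
  \<open>2 q + 2\<close> points.  So the kernel of the evaluation map is spanned by \<open>Q\<close>, and the code has
  \<open>q\<^sup>1\<^sup>0 / q\<close> words.  Equality is attained by two planes through the polar line of a secant: that line misses
  the quadric, and for \<open>q \<ge> 3\<close> the planes through it cannot cover all points unless two of
  them meet the quadric in \<open>q + 1\<close> points.
\<close>

section \<open>Counting along parallel lines\<close>

abbreviation linear_form :: "('a::field ^ 'n \<Rightarrow> 'a) \<Rightarrow> bool" where
  "linear_form \<equiv> Vector_Spaces.linear (*s) (*)"

lemma linear_form_iff:
  "linear_form L \<longleftrightarrow> (\<forall>x y. L (x + y) = L x + L y) \<and> (\<forall>c x. L (c *s x) = c * L x)"
  unfolding Vector_Spaces.linear_iff
  by (auto simp: vec.vector_space_axioms vector_space_def algebra_simps)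

lemma linear_form_zero: "linear_form L \<Longrightarrow> L 0 = 0"
  by (metis add_cancel_left_left linear_form_iff add.right_neutral)

lemma linear_form_diff: "linear_form L \<Longrightarrow> L (x - y) = L x - L y"
  by (metis add_diff_cancel_right' diff_add_cancel linear_form_iff)

text \<open>Double counting of the pairs \<open>(v, t)\<close> with \<open>P (v + t *s p)\<close>:
  for every \<open>t\<close> the shift by \<open>t *s p\<close> permutes \<open>S\<close>, so each
  point satisfying \<open>P\<close> is reached once per scalar.\<close>

lemma line_count:
  fixes p :: "'a::{field,finite} ^ 'n"
  assumes S: "\<And>v t. v \<in> S \<Longrightarrow> v + t *s p \<in> S"
  shows "CARD('a) * card {v \<in> S. P v} = (\<Sum>v\<in>S. card {t. P (v + t *s p)})"
proof -
  have S': "v - t *s p \<in> S" if "v \<in> S" for v t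
    using S[OF that, of "- t"] by simp
  have "(\<Sum>v\<in>S. card {t. P (v + t *s p)}) = card (SIGMA v:S. {t. P (v + t *s p)})"
    by simp
  also have "\<dots> = card ({v \<in> S. P v} \<times> (UNIV :: 'a set))"
    by (rule bij_betw_same_card[of "\<lambda>(v, t). (v + t *s p, t)"],
        rule bij_betwI[where g = "\<lambda>(v, t). (v - t *s p, t)"])
       (auto simp: S S')
  finally show ?thesis by (simp add: card_cartesian_product mult.commute)
qed

lemma line_count_eq:
  fixes p :: "'a::{field,finite} ^ 'n"
  assumes "\<And>v t. v \<in> S \<Longrightarrow> v + t *s p \<in> S"
    and "\<And>v. v \<in> S \<Longrightarrow> \<exists>!t. P (v + t *s p)"
  shows "CARD('a) * card {v \<in> S. P v} = card S"
proof -
  have "card {t. P (v + t *s p)} = 1" if "v \<in> S" for v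
    using assms(2)[OF that] by (auto simp: card_1_singleton_iff)
  then show ?thesis
    by (simp add: line_count[OF assms(1)])
qed

lemma line_count_le:
  fixes p :: "'a::{field,finite} ^ 'n"
  assumes "\<And>v t. v \<in> S \<Longrightarrow> v + t *s p \<in> S"
    and "\<And>v. v \<in> S \<Longrightarrow> card {t. P (v + t *s p)} \<le> k"
  shows "CARD('a) * card {v \<in> S. P v} \<le> k * card S"
proof -
  have "(\<Sum>v\<in>S. card {t. P (v + t *s p)}) \<le> (\<Sum>v\<in>S. k)"
    by (intro sum_mono assms(2))
  then show ?thesis
    by (simp add: line_count[OF assms(1)] mult.commute)
qed

lemma affine_root_ex1: "(b::'a::field) \<noteq> 0 \<Longrightarrow> \<exists>!t. a + t * b = 0"
  by (rule ex1I[of _ "- a / b"]) (auto simp: field_simps eq_neg_iff_add_eq_0)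

lemma card_quadratic_roots_le:
  fixes a b c :: "'a::{field,finite}"
  assumes "c \<noteq> 0"
  shows "card {t. a + t * b + t\<^sup>2 * c = 0} \<le> 2"
proof (cases "\<exists>t. a + t * b + t\<^sup>2 * c = 0")
  case True
  then obtain t where t: "a + t * b + t\<^sup>2 * c = 0" by blast
  have "s \<in> {t, - b / c - t}" if s: "a + s * b + s\<^sup>2 * c = 0" for s
  proof -
    have "(s - t) * (b + c * (s + t)) = 0"
      using s t by algebra
    then have "s = t \<or> c * (s + t) = - b" by (auto simp: eq_neg_iff_add_eq_0 add.commute)
    then have "s = t \<or> s + t = - b / c"
      using assms by (metis nonzero_mult_div_cancel_left)
    then show ?thesis by (auto simp: eq_diff_eq)
  qed
  then have "{t. a + t * b + t\<^sup>2 * c = 0} \<subseteq> {t, - b / c - t}" by blast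
  then have "card {t. a + t * b + t\<^sup>2 * c = 0} \<le> card {t, - b / c - t}"
    by (intro card_mono) auto
  also have "\<dots> \<le> 2" by (simp add: card_insert_if)
  finally show ?thesis .
qed auto

lemma card_plane:
  fixes L :: "'a::{field,finite} ^ 4 \<Rightarrow> 'a"
  assumes "linear_form L" and "L w \<noteq> 0"
  shows "card {v. L v = 0} = CARD('a) ^ 3"
proof -
  have "CARD('a) * card {v \<in> UNIV. L v = 0} = card (UNIV :: ('a ^ 4) set)"
    using assms by (intro line_count_eq[of _ w]) (auto simp: linear_form_iff intro!: affine_root_ex1)
  then show ?thesis
    by (simp add: power_eq_if)
qed

lemma card_plane_Int:
  fixes L M :: "'a::{field,finite} ^ 4 \<Rightarrow> 'a"
  assumes "linear_form L" "linear_form M" and "L w = 0" "M w \<noteq> 0" and "L u \<noteq> 0"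
  shows "card {v. L v = 0 \<and> M v = 0} = CARD('a) ^ 2"
proof -
  have "CARD('a) * card {v \<in> {v. L v = 0}. M v = 0} = card {v. L v = 0}"
    using assms by (intro line_count_eq[of _ w]) (auto simp: linear_form_iff intro!: affine_root_ex1)
  then show ?thesis
    by (simp add: card_plane[OF assms(1,5)] power_eq_if)
qed

text \<open>A line in the direction \<open>w\<close> meets \<open>U\<close> at most once, since two
  points of \<open>U\<close> on it would differ by a nonzero multiple of \<open>w\<close>.\<close>

lemma card_subspace_le:
  fixes w :: "'a::{field,finite} ^ 4"
  assumes "\<And>x y. x \<in> U \<Longrightarrow> y \<in> U \<Longrightarrow> x - y \<in> U" and "\<And>c x. x \<in> U \<Longrightarrow> c *s x \<in> U"
    and "w \<notin> U"
  shows "card U \<le> CARD('a) ^ 3"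
proof -
  have "card {t. v + t *s w \<in> U} \<le> 1" for v
  proof -
    have "s = t" if "v + s *s w \<in> U" "v + t *s w \<in> U" for s t
    proof (rule ccontr)
      assume "s \<noteq> t"
      have "(v + s *s w) - (v + t *s w) = (s - t) *s w"
        by (simp add: vec.scale_left_diff_distrib)
      then have "(s - t) *s w \<in> U" using assms(1)[OF that] by simp
      moreover have "w = inverse (s - t) *s ((s - t) *s w)"
        using \<open>s \<noteq> t\<close> by (simp only: vec.scale_scale) simp
      ultimately have "w \<in> U" using assms(2) by metis
      then show False using assms(3) by simp
    qed
    then show ?thesis
      using card_le_Suc0_iff_eq[of "{t. v + t *s w \<in> U}"] by auto
  qed
  then have "CARD('a) * card {v \<in> UNIV. v \<in> U} \<le> 1 * card (UNIV :: ('a ^ 4) set)"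
    by (intro line_count_le[of _ w]) auto
  then show ?thesis
    by (simp add: power_eq_if)
qed

section \<open>Quadratic forms\<close>

text \<open>The bilinear form attached to a quadratic form, without division by 2, so that even
  \<open>q\<close> is covered.\<close>

definition polar :: "('a::field ^ 'n \<Rightarrow> 'a) \<Rightarrow> 'a ^ 'n \<Rightarrow> 'a ^ 'n \<Rightarrow> 'a" where
  "polar h x y = h (x + y) - h x - h y"

text \<open>A coordinate-free notion that is adequate in every characteristic. Linearity is demanded
  in one argument because \<open>polar\<close> is symmetric.\<close>

definition quadratic_form :: "('a::field ^ 'n \<Rightarrow> 'a) \<Rightarrow> bool" where
  "quadratic_form h \<longleftrightarrow>
     (\<forall>c x. h (c *s x) = c\<^sup>2 * h x) \<and> (\<forall>x. linear_form (polar h x))"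

lemma polar_commute: "polar h x y = polar h y x"
  by (simp add: polar_def add.commute)

lemma quadratic_form_scale: "quadratic_form h \<Longrightarrow> h (c *s x) = c\<^sup>2 * h x"
  by (simp add: quadratic_form_def)

lemma quadratic_form_polar: "quadratic_form h \<Longrightarrow> linear_form (polar h x)"
  by (simp add: quadratic_form_def)

lemma quadratic_form_zero: "quadratic_form h \<Longrightarrow> h 0 = 0"
  using quadratic_form_scale[of h 0 0] by simp

lemma quadratic_form_add: "h (x + y) = h x + h y + polar h x y"
  by (simp add: polar_def)

lemma polar_scale: "quadratic_form h \<Longrightarrow> polar h x (c *s y) = c * polar h x y"
  using quadratic_form_polar[of h x] by (simp add: linear_form_iff)

lemma polar_scale_left: "quadratic_form h \<Longrightarrow> polar h (c *s x) y = c * polar h x y"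
  by (metis polar_scale polar_commute)

lemma polar_add: "quadratic_form h \<Longrightarrow> polar h x (y + z) = polar h x y + polar h x z"
  using quadratic_form_polar[of h x] by (simp add: linear_form_iff)

lemma polar_diff: "quadratic_form h \<Longrightarrow> polar h x (y - z) = polar h x y - polar h x z"
  using quadratic_form_polar[of h x] by (simp add: linear_form_diff)

text \<open>For \<open>h p = 0\<close> the restriction to the line is affine in \<open>t\<close>
  with slope \<open>polar h p v\<close>; for \<open>h p \<noteq> 0\<close> it has at most two roots.
  All counts of zeros rest on this.\<close>

lemma quadratic_form_line:
  "quadratic_form h \<Longrightarrow> h (v + t *s p) = h v + t * polar h p v + t\<^sup>2 * h p"
  by (simp add: quadratic_form_add polar_scale_left quadratic_form_scale polar_commute[of h v])

lemma polar_self: 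
  assumes "quadratic_form h" shows "polar h x x = 2 * h x"
proof -
  have "x + x = 2 *s x" by (simp add: vec_eq_iff)
  then show ?thesis
    by (simp only: polar_def quadratic_form_scale[OF assms]) (simp add: power2_eq_square)
qed

lemma quadratic_form_plus:
  assumes "quadratic_form g" "quadratic_form h"
  shows "quadratic_form (\<lambda>x. g x + h x)"
proof -
  have "polar (\<lambda>x. g x + h x) x = (\<lambda>y. polar g x y + polar h x y)" for x
    by (auto simp: polar_def)
  then show ?thesis
    using assms unfolding quadratic_form_def linear_form_iff
    by (simp add: algebra_simps)
qed

lemma quadratic_form_cmult:
  assumes "quadratic_form h"
  shows "quadratic_form (\<lambda>x. c * h x)"
proof -
  have "polar (\<lambda>x. c * h x) x = (\<lambda>y. c * polar h x y)" for x
    by (auto simp: polar_def algebra_simps)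
  then show ?thesis
    using assms unfolding quadratic_form_def linear_form_iff
    by (simp add: algebra_simps)
qed

lemma quadratic_form_sum:
  assumes "\<And>i. i \<in> I \<Longrightarrow> quadratic_form (h i)"
  shows "quadratic_form (\<lambda>x. \<Sum>i\<in>I. h i x)"
  using assms
proof (induction I rule: infinite_finite_induct)
  case (insert i I)
  then show ?case by (simp add: quadratic_form_plus)
qed (auto simp: quadratic_form_def polar_def linear_form_iff)

lemma quadratic_form_times:
  assumes "linear_form L" "linear_form M"
  shows "quadratic_form (\<lambda>x. L x * M x)"
proof -
  have "polar (\<lambda>x. L x * M x) x = (\<lambda>y. L x * M y + L y * M x)" for x
    using assms by (auto simp: polar_def linear_form_iff algebra_simps)
  then show ?thesis
    using assms unfolding quadratic_form_def linear_form_iff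
    by (simp add: algebra_simps power2_eq_square)
qed

lemma linear_form_nth: "linear_form (\<lambda>x. x $ i)"
  by (simp add: linear_form_iff)

section \<open>Numbers of zeros of a quadratic form on affine 4-space\<close>

lemma card_zeros_off_tangent:
  fixes h :: "'a::{field,finite} ^ 4 \<Rightarrow> 'a"
  assumes h: "quadratic_form h" and p: "h p = 0" "polar h p w \<noteq> 0"
  shows "card {v. h v = 0 \<and> polar h p v \<noteq> 0} = CARD('a) ^ 3 - CARD('a) ^ 2"
proof -
  let ?q = "CARD('a)"
  \<comment> \<open>Since \<open>polar h p p = 2 * h p = 0\<close>, the slope is constant along
    lines in the direction \<open>p\<close>; off the tangent space it is nonzero, so each such line
    carries exactly one zero.\<close>
  have pp: "polar h p (v + t *s p) = polar h p v" for v t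
    using h p(1) by (simp add: polar_add polar_scale polar_self)
  have "?q * card {v \<in> {v. polar h p v \<noteq> 0}. h v = 0} = card {v. polar h p v \<noteq> 0}"
    by (intro line_count_eq[of _ p])
       (auto simp: pp quadratic_form_line[OF h] p(1) intro!: affine_root_ex1)
  also have "{v. polar h p v \<noteq> 0} = UNIV - {v. polar h p v = 0}" by auto
  also have "card \<dots> = ?q ^ 4 - ?q ^ 3"
    by (simp add: card_Diff_subset card_plane[OF quadratic_form_polar[OF h] p(2)])
  also have "\<dots> = ?q * (?q ^ 3 - ?q ^ 2)"
    by (simp add: right_diff_distrib' power_eq_if)
  finally show ?thesis by (simp add: conj_commute)
qed

lemma card_zeros_subspace_le:
  fixes h :: "'a::{field,finite} ^ 4 \<Rightarrow> 'a"
  assumes h: "quadratic_form h" and "h w \<noteq> 0" and "\<And>v t. v \<in> S \<Longrightarrow> v + t *s w \<in> S"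
  shows "CARD('a) * card {v \<in> S. h v = 0} \<le> 2 * card S"
  using assms(2)
  by (intro line_count_le[OF assms(3)])
     (auto simp: quadratic_form_line[OF h] intro!: card_quadratic_roots_le)

text \<open>If all zeros are singular, they form a proper subspace. Otherwise take the tangent space
  of a nonsingular zero: either \<open>h\<close> is nonzero somewhere on it, which bounds the zeros
  there, or \<open>h\<close> vanishes on it and its equation divides \<open>h\<close>.\<close>

lemma quadratic_form_few_zeros_or_product:
  fixes h :: "'a::{field,finite} ^ 4 \<Rightarrow> 'a"
  assumes h: "quadratic_form h" and "h u \<noteq> 0"
  obtains "card {v. h v = 0} \<le> CARD('a) ^ 3 + CARD('a) ^ 2"
  | L M x y where "linear_form L" "linear_form M" "L x \<noteq> 0" "M y \<noteq> 0" "h = (\<lambda>v. L v * M v)"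
proof (cases "\<forall>p. h p = 0 \<longrightarrow> (\<forall>v. polar h p v = 0)")
  case True
  have "card {v. h v = 0} \<le> CARD('a) ^ 3"
  proof (rule card_subspace_le[of _ u])
    fix x y assume xy: "x \<in> {v. h v = 0}" "y \<in> {v. h v = 0}"
    have "h (x + (-1) *s y) = 0"
      using xy True by (simp only: quadratic_form_line[OF h]) simp
    then show "x - y \<in> {v. h v = 0}" by simp
  qed (use assms in \<open>auto simp: quadratic_form_scale\<close>)
  then show ?thesis using that(1) by simp
next
  case False
  then obtain p w where p: "h p = 0" and w0: "polar h p w \<noteq> 0" by blast
  define L where "L = polar h p"
  have L: "linear_form L" unfolding L_def by (rule quadratic_form_polar[OF h])
  let ?q = "CARD('a)"
  show ?thesis
  proof (cases "\<exists>z. L z = 0 \<and> h z \<noteq> 0")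
    case True
    then obtain z where z: "L z = 0" "h z \<noteq> 0" by blast
    \<comment> \<open>Inside the tangent space, each line in the direction \<open>z\<close> carries
      at most two zeros because \<open>h z \<noteq> 0\<close>.\<close>
    have "?q * card {v \<in> {v. L v = 0}. h v = 0} \<le> 2 * card {v. L v = 0}"
      using L z(1) by (intro card_zeros_subspace_le[OF h z(2)]) (auto simp: linear_form_iff)
    moreover have "card {v. L v = 0} = ?q ^ 3"
      using card_plane[OF L, of w] w0 by (simp add: L_def)
    ultimately have 1: "card {v. L v = 0 \<and> h v = 0} \<le> 2 * ?q ^ 2"
      by (simp add: power_eq_if)
    have 2: "card {v. h v = 0 \<and> L v \<noteq> 0} = ?q ^ 3 - ?q ^ 2"
      unfolding L_def by (rule card_zeros_off_tangent[OF h p w0])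
    have "{v. h v = 0} = {v. L v = 0 \<and> h v = 0} \<union> {v. h v = 0 \<and> L v \<noteq> 0}" by auto
    then have "card {v. h v = 0} \<le> 2 * ?q ^ 2 + (?q ^ 3 - ?q ^ 2)"
      using card_Un_le[of "{v. L v = 0 \<and> h v = 0}" "{v. h v = 0 \<and> L v \<noteq> 0}"] 1 2 by simp
    also have "\<dots> = ?q ^ 3 + ?q ^ 2"
      using power_increasing[of 2 3 ?q] by simp
    finally show ?thesis using that(1) by blast
  next
    case F: False
    define w' where "w' = inverse (L w) *s w"
    have w': "L w' = 1" using L w0 by (simp add: w'_def linear_form_iff L_def)
    \<comment> \<open>The cofactor of \<open>L\<close>: expand \<open>h\<close> along the
      decomposition of \<open>v\<close> into a vector of the kernel of \<open>L\<close>, where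
      \<open>h\<close> vanishes, and the multiple \<open>L v *s w'\<close>.\<close>
    define M where "M v = L v * h w' + polar h w' (v - L v *s w')" for v
    have M: "linear_form M"
      using L unfolding M_def linear_form_iff
      by (simp add: polar_diff polar_add polar_scale h algebra_simps)
    have hLM: "h v = L v * M v" for v
    proof -
      define z where "z = v - L v *s w'"
      have "L z = 0" using L w' by (simp add: z_def linear_form_diff linear_form_iff)
      then have "h z = 0" using F by blast
      have "v = z + L v *s w'" by (simp add: z_def)
      then have "h v = h z + L v * polar h w' z + (L v)\<^sup>2 * h w'"
        using quadratic_form_line[OF h] by metis
      then show ?thesis
        using \<open>h z = 0\<close> by (simp add: M_def z_def power2_eq_square algebra_simps)
    qed
    have "M u \<noteq> 0" using assms(2) hLM[of u] by auto
    moreover have "L w \<noteq> 0" using w0 by (simp add: L_def)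
    ultimately show ?thesis using that(2) L M hLM by blast
  qed
qed

section \<open>Elliptic quadratic forms\<close>

text \<open>The number of zeros is 1 + (q - 1)(q^2 + 1), written as a sum to avoid truncated
  subtraction. \<open>nonsingular\<close> is the form in which rank 4 is used.\<close>

locale elliptic_form =
  fixes Q :: "'a::{field,finite} ^ 4 \<Rightarrow> 'a" and q :: nat
  assumes form: "quadratic_form Q"
    and nonsingular: "\<And>p. p \<noteq> 0 \<Longrightarrow> Q p = 0 \<Longrightarrow> \<exists>w. polar Q p w \<noteq> 0"
    and card_field: "CARD('a) = q"
    and q_ge_3: "q \<ge> 3"
    and card_zeros: "card {v. Q v = 0} + q\<^sup>2 = q ^ 3 + q"
begin

lemma power_q: "q\<^sup>2 = q * q" "q ^ 3 = q * q * q" "q ^ 4 = q * q * q * q"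
  by (simp_all add: power_eq_if)

lemma card_nontangent_zeros:
  assumes "p \<noteq> 0" "Q p = 0"
  shows "card {v. Q v = 0 \<and> polar Q p v \<noteq> 0} + q\<^sup>2 = q ^ 3"
proof -
  have "q\<^sup>2 \<le> q ^ 3" using q_ge_3 by (intro power_increasing) auto
  then show ?thesis
    using nonsingular[OF assms] card_zeros_off_tangent[OF form assms(2)] by (auto simp: card_field)
qed

text \<open>Removing the q^3 - q^2 zeros off the tangent space from all q^3 - q^2 + q zeros leaves
  q, and the multiples of \<open>p\<close> already account for these.\<close>

lemma tangent_zeros:
  assumes "p \<noteq> 0" "Q p = 0"
  shows "{v. Q v = 0 \<and> polar Q p v = 0} = range (\<lambda>t. t *s p)"
proof -
  have "{v. Q v = 0} = {v. Q v = 0 \<and> polar Q p v \<noteq> 0} \<union> {v. Q v = 0 \<and> polar Q p v = 0}"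
    by auto
  then have "card {v. Q v = 0} =
      card {v. Q v = 0 \<and> polar Q p v \<noteq> 0} + card {v. Q v = 0 \<and> polar Q p v = 0}"
    by (metis (mono_tags, lifting) card_Un_disjoint finite_class.finite_code disjoint_iff mem_Collect_eq)
  then have "card {v. Q v = 0 \<and> polar Q p v = 0} = q"
    using card_zeros card_nontangent_zeros[OF assms] by linarith
  moreover have "inj (\<lambda>t. t *s p)"
    using assms(1) by (auto simp: inj_on_def)
  then have "card (range (\<lambda>t. t *s p)) = q"
    by (simp add: card_image card_field)
  moreover have "range (\<lambda>t. t *s p) \<subseteq> {v. Q v = 0 \<and> polar Q p v = 0}"
    using assms form by (auto simp: quadratic_form_scale polar_scale polar_self)
  ultimately show ?thesis
    by (intro card_subset_eq[symmetric]) auto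
qed

text \<open>Projectively, a plane has 0, 1 or q + 1 points on the quadric. The value q belongs to
  tangent planes; a plane through a zero \<open>p\<close> other than the tangent plane at
  \<open>p\<close> gives q^2.\<close>

lemma card_plane_section:
  assumes L: "linear_form L" and "L x \<noteq> 0"
  shows "card {v. Q v = 0 \<and> L v = 0} \<in> {1, q, q\<^sup>2}"
proof (cases "\<exists>p. p \<noteq> 0 \<and> Q p = 0 \<and> L p = 0")
  case False
  then have "{v. Q v = 0 \<and> L v = 0} = {0}"
    using form L by (auto simp: quadratic_form_zero linear_form_zero)
  then show ?thesis by simp
next
  case True
  then obtain p where p: "p \<noteq> 0" "Q p = 0" "L p = 0" by blast
  let ?T = "polar Q p"
  have T: "linear_form ?T" by (rule quadratic_form_polar[OF form])
  have "card (range (\<lambda>t. t *s p)) = q"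
    using p(1) by (subst card_image) (auto simp: card_field inj_on_def)
  moreover have *: "{v. Q v = 0 \<and> L v = 0 \<and> ?T v = 0} = range (\<lambda>t. t *s p)"
    using tangent_zeros[OF p(1,2)] p(3) L by (auto simp: set_eq_iff linear_form_iff)
  ultimately have tangent: "card {v. Q v = 0 \<and> L v = 0 \<and> ?T v = 0} = q" by simp
  show ?thesis
  proof (cases "\<exists>w. L w = 0 \<and> ?T w \<noteq> 0")
    case False
    then have "{v. Q v = 0 \<and> L v = 0} = {v. Q v = 0 \<and> L v = 0 \<and> ?T v = 0}" by auto
    then show ?thesis using tangent by simp
  next
    case True
    then obtain w where w: "L w = 0" "?T w \<noteq> 0" by blast
    have pp: "?T (v + t *s p) = ?T v" for v t
      using form p(2) by (simp add: polar_add polar_scale polar_self)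
    \<comment> \<open>Within the plane, lines in the direction \<open>p\<close> off the tangent
      space again carry one zero each.\<close>
    have "q * card {v \<in> {v. L v = 0 \<and> ?T v \<noteq> 0}. Q v = 0} = card {v. L v = 0 \<and> ?T v \<noteq> 0}"
      unfolding card_field[symmetric] using L p(3)
      by (intro line_count_eq[of _ p])
         (auto simp: pp quadratic_form_line[OF form] p(2) linear_form_iff intro!: affine_root_ex1)
    also have "{v. L v = 0 \<and> ?T v \<noteq> 0} = {v. L v = 0} - {v. L v = 0 \<and> ?T v = 0}" by auto
    also have "card \<dots> = q ^ 3 - q\<^sup>2"
      by (subst card_Diff_subset)
         (auto simp: card_plane[OF assms] card_plane_Int[OF L T w assms(2)] card_field)
    also have "\<dots> = q * (q\<^sup>2 - q)"
      by (simp add: power_q algebra_simps)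
    finally have "card {v. L v = 0 \<and> ?T v \<noteq> 0 \<and> Q v = 0} = q\<^sup>2 - q"
      using q_ge_3 by (simp cong: conj_cong)
    moreover have "{v. Q v = 0 \<and> L v = 0} =
        {v. L v = 0 \<and> ?T v \<noteq> 0 \<and> Q v = 0} \<union> {v. Q v = 0 \<and> L v = 0 \<and> ?T v = 0}" by auto
    then have "card {v. Q v = 0 \<and> L v = 0} =
        card {v. L v = 0 \<and> ?T v \<noteq> 0 \<and> Q v = 0} + card {v. Q v = 0 \<and> L v = 0 \<and> ?T v = 0}"
      by (simp add: card_Un_disjoint disjoint_iff)
    ultimately have "card {v. Q v = 0 \<and> L v = 0} = q\<^sup>2"
      using tangent q_ge_3 by (simp add: power_q)
    then show ?thesis by simp
  qed
qed

section \<open>Upper bound for the common zeros of \<open>Q\<close> and another form\<close>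

lemma card_two_planes_le:
  assumes "linear_form L" "linear_form M" "L x \<noteq> 0" "M y \<noteq> 0"
  shows "card {v. Q v = 0 \<and> L v * M v = 0} < 2 * q\<^sup>2"
proof -
  let ?A = "{v. Q v = 0 \<and> L v = 0}" and ?B = "{v. Q v = 0 \<and> M v = 0}"
  have "1 \<le> q" "q \<le> q\<^sup>2" using q_ge_3 by (auto simp: power_q)
  then have "card ?A \<le> q\<^sup>2" "card ?B \<le> q\<^sup>2"
    using card_plane_section[OF assms(1,3)] card_plane_section[OF assms(2,4)] by auto
  \<comment> \<open>The zero vector lies in both sections, which makes the bound strict.\<close>
  moreover have "0 \<in> ?A \<inter> ?B"
    using assms form by (auto simp: quadratic_form_zero linear_form_zero)
  then have "card (?A \<inter> ?B) > 0" by (auto simp: card_gt_0_iff)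
  moreover have "card ?A + card ?B = card (?A \<union> ?B) + card (?A \<inter> ?B)"
    by (rule card_Un_Int) auto
  moreover have "{v. Q v = 0 \<and> L v * M v = 0} = ?A \<union> ?B" by auto
  ultimately show ?thesis by simp
qed

text \<open>A common zero of \<open>Q\<close> and \<open>h\<close> is a zero of all \<open>q\<close>
  members of the pencil, any other zero of \<open>Q\<close> of none, and a vector off the quadric of
  exactly one.\<close>

lemma sum_card_pencil:
  "(\<Sum>c\<in>UNIV. card {v. h v + c * Q v = 0}) + card {v. Q v = 0} =
     q * card {v. Q v = 0 \<and> h v = 0} + q ^ 4"
proof -
  have line: "card {c. h v + c * Q v = 0} =
      (if Q v = 0 then if h v = 0 then q else 0 else 1)" for v
  proof (cases "Q v = 0")
    case False
    then have "\<exists>!c. h v + c * Q v = 0" by (rule affine_root_ex1)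
    then obtain c where "{c. h v + c * Q v = 0} = {c}" by blast
    then show ?thesis using False by simp
  qed (simp add: card_field)
  have "(\<Sum>c\<in>UNIV. card {v. h v + c * Q v = 0}) = card (SIGMA c:UNIV. {v. h v + c * Q v = 0})"
    by simp
  also have "\<dots> = card (SIGMA v:UNIV. {c. h v + c * Q v = 0})"
    by (rule bij_betw_same_card[of prod.swap]) (auto intro!: bij_betwI[where g = prod.swap])
  also have "\<dots> = (\<Sum>v\<in>UNIV. (if Q v = 0 \<and> h v = 0 then q else 0) + (if Q v \<noteq> 0 then 1 else 0))"
    by (simp add: line) (rule sum.cong, auto)
  also have "\<dots> = q * card {v. Q v = 0 \<and> h v = 0} + card {v. Q v \<noteq> 0}"
    by (simp add: sum.distrib flip: sum.inter_filter)
  finally have "(\<Sum>c\<in>UNIV. card {v. h v + c * Q v = 0}) =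
      q * card {v. Q v = 0 \<and> h v = 0} + card {v. Q v \<noteq> 0}" .
  moreover have "card {v. Q v \<noteq> 0} + card {v. Q v = 0} = q ^ 4"
  proof -
    have "{v. Q v \<noteq> 0} = UNIV - {v. Q v = 0}" by auto
    then show ?thesis
      using card_mono[of UNIV "{v. Q v = 0}"] by (simp add: card_Diff_subset card_field)
  qed
  ultimately show ?thesis by simp
qed

lemma card_common_zeros_le:
  assumes h: "quadratic_form h" and ne: "\<And>c. \<exists>v. h v \<noteq> c * Q v"
  shows "card {v. Q v = 0 \<and> h v = 0} < 2 * q\<^sup>2"
proof (rule ccontr)
  assume neg: "\<not> ?thesis"
  have "card {v. h v + c * Q v = 0} \<le> q ^ 3 + q\<^sup>2" for c
  proof -
    have hc: "quadratic_form (\<lambda>v. h v + c * Q v)"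
      by (intro quadratic_form_plus quadratic_form_cmult h form)
    obtain u where "h u \<noteq> (- c) * Q u" using ne by blast
    then have u: "h u + c * Q u \<noteq> 0" by (simp add: eq_neg_iff_add_eq_0)
    show ?thesis
    proof (rule quadratic_form_few_zeros_or_product[of "\<lambda>v. h v + c * Q v", OF hc u])
      fix L M x y
      assume LM: "linear_form L" "linear_form M" "L x \<noteq> 0" "M y \<noteq> 0"
        and eq: "(\<lambda>v. h v + c * Q v) = (\<lambda>v. L v * M v)"
      \<comment> \<open>All members of the pencil agree with \<open>h\<close> on the zeros of
        \<open>Q\<close>, so a member that is a product would put the common zeros into two
        planes.\<close>
      have "{v. Q v = 0 \<and> h v = 0} = {v. Q v = 0 \<and> L v * M v = 0}"
        unfolding fun_cong[OF eq, symmetric] by auto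
      then show ?thesis
        using card_two_planes_le[OF LM] neg by simp
    qed (simp add: card_field)
  qed
  then have "(\<Sum>c\<in>(UNIV :: 'a set). card {v. h v + c * Q v = 0}) \<le> (\<Sum>c\<in>(UNIV :: 'a set). q ^ 3 + q\<^sup>2)"
    by (intro sum_mono)
  \<comment> \<open>For N common zeros this gives q N <= q^3 + (q^3 - q^2 + q) < 2 q^3,
    contradicting N >= 2 q^2.\<close>
  then have "q * card {v. Q v = 0 \<and> h v = 0} + q ^ 4 \<le> q * (q ^ 3 + q\<^sup>2) + card {v. Q v = 0}"
    using sum_card_pencil[of h] by (simp add: card_field)
  then have "q * card {v. Q v = 0 \<and> h v = 0} \<le> q ^ 3 + card {v. Q v = 0}"
    by (simp add: power_q algebra_simps)
  moreover have "q * (2 * q\<^sup>2) \<le> q * card {v. Q v = 0 \<and> h v = 0}"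
    using neg by (intro mult_left_mono) auto
  then have "2 * q ^ 3 \<le> q * card {v. Q v = 0 \<and> h v = 0}"
    by (simp add: power_q algebra_simps)
  moreover have "q\<^sup>2 > q" using q_ge_3 by (simp add: power_q)
  ultimately show False
    using card_zeros by linarith
qed

section \<open>A pair of planes attaining the upper bound\<close>

lemma exists_zero: "\<exists>p. p \<noteq> 0 \<and> Q p = 0"
proof (rule ccontr)
  assume "\<not> ?thesis"
  then have "{v. Q v = 0} \<subseteq> {0}" by auto
  then have "card {v. Q v = 0} \<le> card {0 :: 'a ^ 4}" by (intro card_mono) auto
  moreover have "q\<^sup>2 \<le> q ^ 3" using q_ge_3 by (intro power_increasing) auto
  ultimately show False
    using card_zeros q_ge_3 by simp
qed

lemma exists_max_common_zeros:
  obtains h where "quadratic_form h" "card {v. Q v = 0 \<and> h v = 0} + 1 = 2 * q\<^sup>2"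
proof -
  obtain p where p: "p \<noteq> 0" "Q p = 0" using exists_zero by blast
  have "q\<^sup>2 < q ^ 3" using q_ge_3 by (intro power_strict_increasing) auto
  then have "card {v. Q v = 0 \<and> polar Q p v \<noteq> 0} \<noteq> 0"
    using card_nontangent_zeros[OF p] by linarith
  then obtain r where r: "Q r = 0" "polar Q p r \<noteq> 0"
    by (metis (mono_tags, lifting) Collect_empty_eq card.empty)
  have "r \<noteq> 0" using r(2) linear_form_zero[OF quadratic_form_polar[OF form]] by metis
  text \<open>The polar line of the secant through \<open>p\<close> and \<open>r\<close> misses the quadric.\<close>
  have ext: "v = 0" if "Q v = 0" "polar Q p v = 0" "polar Q r v = 0" for v
  proof -
    from that tangent_zeros[OF p] obtain t where t: "v = t *s p" by auto
    with that(3) have "t * polar Q p r = 0"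
      using polar_scale[OF form, of r t p] by (simp add: polar_commute[of Q r p])
    then show ?thesis using r(2) t by simp
  qed
  \<comment> \<open>These are the planes through the polar line other than the tangent plane at
    \<open>p\<close>; none of them contains \<open>p\<close>.\<close>
  define M where "M c v = polar Q r v + c * polar Q p v" for c v
  have M: "linear_form (M c)" for c
    using quadratic_form_polar[OF form] by (auto simp: M_def linear_form_iff algebra_simps)
  have Mp: "M c p \<noteq> 0" for c
    using r(2) p form by (simp add: M_def polar_self polar_commute[of Q r p])
  have disjoint: "v = 0" if "Q v = 0" "M c v = 0" "M d v = 0" "c \<noteq> d" for v c d
  proof -
    have "(c - d) * polar Q p v = 0" using that(2,3) unfolding M_def by algebra
    then have 0: "polar Q p v = 0" using that(4) by simp
    moreover from this have "polar Q r v = 0" using that(2) by (simp add: M_def)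
    ultimately show ?thesis using ext that(1) by blast
  qed
  let ?S = "\<lambda>c. {v. Q v = 0 \<and> M c v = 0}"
  have "\<exists>c d. c \<noteq> d \<and> card (?S c) = q\<^sup>2 \<and> card (?S d) = q\<^sup>2"
  proof (rule ccontr)
    assume neg: "\<not> ?thesis"
    have small: "card (?S c) \<le> q" if "card (?S c) \<noteq> q\<^sup>2" for c
      using card_plane_section[OF M Mp, of c] that q_ge_3 by auto
    \<comment> \<open>At most one section is large: \<open>c0\<close> is its index, or arbitrary if
      there is none.\<close>
    obtain c0 where "\<And>c. c \<noteq> c0 \<Longrightarrow> card (?S c) \<noteq> q\<^sup>2"
      using neg by blast
    then have c0: "card (?S c) \<le> q" if "c \<noteq> c0" for c
      using small that by blast
    have "{v. Q v = 0 \<and> polar Q p v \<noteq> 0} \<subseteq> (\<Union>c\<in>UNIV. ?S c - {0})"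
    proof
      fix v assume v: "v \<in> {v. Q v = 0 \<and> polar Q p v \<noteq> 0}"
      then have "v \<noteq> 0" using linear_form_zero[OF quadratic_form_polar[OF form]] by auto
      obtain c where "polar Q r v + c * polar Q p v = 0"
        using affine_root_ex1[of "polar Q p v"] v by blast
      then show "v \<in> (\<Union>c\<in>UNIV. ?S c - {0})" using v \<open>v \<noteq> 0\<close> by (auto simp: M_def)
    qed
    then have "card {v. Q v = 0 \<and> polar Q p v \<noteq> 0} \<le> card (\<Union>c\<in>UNIV. ?S c - {0})"
      by (intro card_mono) auto
    also have "\<dots> \<le> (\<Sum>c\<in>UNIV. card (?S c - {0}))"
      by (rule card_UN_le) simp
    also have "\<dots> = (\<Sum>c\<in>UNIV. card (?S c) - 1)"
      using form M by (intro sum.cong refl card_Diff_singleton) (auto simp: quadratic_form_zero linear_form_zero)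
    also have "\<dots> = (card (?S c0) - 1) + (\<Sum>c\<in>UNIV - {c0}. card (?S c) - 1)"
      by (rule sum.remove) auto
    finally have 1: "card {v. Q v = 0 \<and> polar Q p v \<noteq> 0}
        \<le> (card (?S c0) - 1) + (\<Sum>c\<in>UNIV - {c0}. card (?S c) - 1)" .
    have "(\<Sum>c\<in>UNIV - {c0}. card (?S c) - 1) \<le> (\<Sum>c\<in>UNIV - {c0}. q - 1)"
      using c0 by (intro sum_mono diff_le_mono) auto
    then have 2: "(\<Sum>c\<in>UNIV - {c0}. card (?S c) - 1) \<le> (q - 1) * (q - 1)"
      by (simp add: card_field card_Diff_singleton)
    have "1 \<le> q" "q \<le> q\<^sup>2" using q_ge_3 by (auto simp: power_q)
    then have "card (?S c0) \<le> q\<^sup>2"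
      using card_plane_section[OF M Mp, of c0] by auto
    \<comment> \<open>The q^3 - q^2 zeros off the tangent space at \<open>p\<close> would fit into
      one large section and q - 1 small ones, each without 0. For q = 2 this would hold with
      equality (4 = 3 + 1); from q = 3 on it fails.\<close>
    then have "q ^ 3 \<le> q\<^sup>2 + (q\<^sup>2 - 1) + (q - 1) * (q - 1)"
      using card_nontangent_zeros[OF p] 1 2 by linarith
    moreover obtain k where k: "q = 3 + k" using q_ge_3 le_Suc_ex by blast
    ultimately show False by (simp add: power2_eq_square power3_eq_cube k algebra_simps)
  qed
  then obtain c d where cd: "c \<noteq> d" "card (?S c) = q\<^sup>2" "card (?S d) = q\<^sup>2" by blast
  have "?S c \<inter> ?S d \<subseteq> {0}"
    using disjoint[OF _ _ _ cd(1)] by blast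
  moreover have "0 \<in> ?S c \<inter> ?S d"
    using form M by (simp add: quadratic_form_zero linear_form_zero)
  ultimately have "?S c \<inter> ?S d = {0}" by blast
  then have "card (?S c \<union> ?S d) + 1 = 2 * q\<^sup>2"
    using card_Un_Int[of "?S c" "?S d"] cd by simp
  moreover have "{v. Q v = 0 \<and> M c v * M d v = 0} = ?S c \<union> ?S d" by auto
  ultimately show ?thesis
    using that[of "\<lambda>v. M c v * M d v"] quadratic_form_times[OF M M] by simp
qed

end

section \<open>Evaluation of polynomials\<close>

abbreviation mono_eval :: "(4 \<Rightarrow>\<^sub>0 nat) \<Rightarrow> 'a::comm_semiring_1 ^ 4 \<Rightarrow> 'a" where
  "mono_eval m x \<equiv> (\<Prod>i\<in>UNIV. x $ i ^ Poly_Mapping.lookup m i)"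

lemma mono_eval_add: "mono_eval (m + n) x = mono_eval m x * mono_eval n x"
  by (simp add: lookup_add power_add prod.distrib)

lemma mono_eval_single [simp]: "mono_eval (Poly_Mapping.single i k) x = x $ i ^ k"
proof -
  have "mono_eval (Poly_Mapping.single i k) x = (\<Prod>j\<in>UNIV. if j = i then x $ i ^ k else 1)"
    by (rule prod.cong) (auto simp: lookup_single when_def)
  then show ?thesis by simp
qed

lemma eval_poly_superset:
  "finite K \<Longrightarrow> Poly_Mapping.keys f \<subseteq> K \<Longrightarrow>
     eval_poly f x = (\<Sum>m\<in>K. Poly_Mapping.lookup f m * mono_eval m x)"
  unfolding eval_poly_def by (rule sum.mono_neutral_left) (auto simp: in_keys_iff)

lemma eval_poly_0 [simp]: "eval_poly 0 x = 0"
  by (simp add: eval_poly_def)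

lemma eval_poly_add [simp]: "eval_poly (f + g) x = eval_poly f x + eval_poly g x"
proof -
  let ?K = "Poly_Mapping.keys f \<union> Poly_Mapping.keys g"
  have "eval_poly (f + g) x = (\<Sum>m\<in>?K. Poly_Mapping.lookup (f + g) m * mono_eval m x)"
    by (rule eval_poly_superset) (auto dest: subsetD[OF keys_add])
  moreover have "eval_poly f x = (\<Sum>m\<in>?K. Poly_Mapping.lookup f m * mono_eval m x)"
    "eval_poly g x = (\<Sum>m\<in>?K. Poly_Mapping.lookup g m * mono_eval m x)"
    by (rule eval_poly_superset; auto)+
  ultimately show ?thesis
    by (simp add: lookup_add distrib_right sum.distrib)
qed

lemma eval_poly_sum [simp]: "eval_poly (\<Sum>i\<in>I. f i) x = (\<Sum>i\<in>I. eval_poly (f i) x)"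
  by (induction I rule: infinite_finite_induct) auto

lemma eval_poly_single [simp]: "eval_poly (Poly_Mapping.single m c) x = c * mono_eval m x"
  by (subst eval_poly_superset[of "{m}"]) auto

lemma poly_mapping_sum_single:
  "f = (\<Sum>m\<in>Poly_Mapping.keys f. Poly_Mapping.single m (Poly_Mapping.lookup f m))"
proof (rule poly_mapping_eqI)
  fix m
  show "Poly_Mapping.lookup f m =
      Poly_Mapping.lookup (\<Sum>m\<in>Poly_Mapping.keys f. Poly_Mapping.single m (Poly_Mapping.lookup f m)) m"
    by (simp add: lookup_sum lookup_single when_def in_keys_iff)
qed

text \<open>Both factors are expanded into monomials, where multiplicativity is
  \<open>mono_eval_add\<close>.\<close>

lemma eval_poly_times [simp]: "eval_poly (f * g) x = eval_poly f x * eval_poly g x"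
proof -
  have "eval_poly ((\<Sum>m\<in>Poly_Mapping.keys f. Poly_Mapping.single m (Poly_Mapping.lookup f m)) *
      (\<Sum>m\<in>Poly_Mapping.keys g. Poly_Mapping.single m (Poly_Mapping.lookup g m))) x =
      eval_poly f x * eval_poly g x"
    unfolding eval_poly_def[of f] eval_poly_def[of g]
    by (simp add: sum_product mult_single mono_eval_add mult_ac)
  then show ?thesis
    by (simp flip: poly_mapping_sum_single)
qed

lemma eval_poly_1 [simp]: "eval_poly 1 x = 1"
  by (simp flip: single_one)

lemma eval_poly_power [simp]: "eval_poly (f ^ n) x = eval_poly f x ^ n"
  by (induction n) auto

lemma eval_poly_prod [simp]: "eval_poly (\<Prod>i\<in>I. f i) x = (\<Prod>i\<in>I. eval_poly (f i) x)"
  by (induction I rule: infinite_finite_induct) auto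

lemma eval_poly_const [simp]: "eval_poly (const_poly c) x = c"
  by (simp add: const_poly_def)

lemma eval_poly_indet [simp]: "eval_poly (indet i) x = x $ i"
  by (simp add: indet_def)

lemma eval_poly_lin_subst: "eval_poly (lin_subst A f) x = eval_poly f (A *v x)"
  by (simp add: lin_subst_def eval_poly_def[of f] matrix_vector_mult_def)

section \<open>Homogeneous polynomials\<close>

definition homogeneous :: "nat \<Rightarrow> 'a::zero poly4 \<Rightarrow> bool" where
  "homogeneous n f \<longleftrightarrow>
     (\<forall>m \<in> Poly_Mapping.keys f. (\<Sum>i\<in>UNIV. Poly_Mapping.lookup m i) = n)"

lemma forms2_iff: "f \<in> forms2 \<longleftrightarrow> homogeneous 2 f"
  by (simp add: forms2_def homogeneous_def)

lemma homogeneous_0: "homogeneous n 0"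
  by (simp add: homogeneous_def)

lemma homogeneous_add: "homogeneous n f \<Longrightarrow> homogeneous n g \<Longrightarrow> homogeneous n (f + g)"
  unfolding homogeneous_def using keys_add[of f g] by blast

lemma homogeneous_sum: "(\<And>i. i \<in> I \<Longrightarrow> homogeneous n (f i)) \<Longrightarrow> homogeneous n (\<Sum>i\<in>I. f i)"
  by (induction I rule: infinite_finite_induct) (auto intro: homogeneous_0 homogeneous_add)

lemma homogeneous_single: "(\<Sum>i\<in>UNIV. Poly_Mapping.lookup m i) = n \<Longrightarrow> homogeneous n (Poly_Mapping.single m c)"
  by (simp add: homogeneous_def)

lemma homogeneous_times:
  fixes f g :: "'a::comm_semiring_1 poly4"
  assumes "homogeneous m f" "homogeneous n g"
  shows "homogeneous (m + n) (f * g)"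
  unfolding homogeneous_def
proof
  fix k assume "k \<in> Poly_Mapping.keys (f * g)"
  then obtain a b where "k = a + b" "a \<in> Poly_Mapping.keys f" "b \<in> Poly_Mapping.keys g"
    using keys_mult[of f g] by blast
  then show "(\<Sum>i\<in>UNIV. Poly_Mapping.lookup k i) = m + n"
    using assms by (simp add: homogeneous_def lookup_add sum.distrib)
qed

lemma homogeneous_const: "homogeneous 0 (const_poly c)"
  by (simp add: homogeneous_def const_poly_def)

lemma homogeneous_indet: "homogeneous 1 (indet i :: 'a::zero_neq_one poly4)"
  by (simp add: homogeneous_def indet_def lookup_single when_def)

lemma homogeneous_power:
  "homogeneous m f \<Longrightarrow> homogeneous (k * m) (f ^ k :: 'a::comm_semiring_1 poly4)"
proof (induction k)
  case 0
  then show ?case using homogeneous_const[of "1 :: 'a"] by (simp add: const_poly_def)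
qed (auto intro: homogeneous_times)

lemma homogeneous_prod:
  fixes f :: "'i \<Rightarrow> 'a::comm_semiring_1 poly4"
  assumes "\<And>i. i \<in> I \<Longrightarrow> homogeneous (n i) (f i)"
  shows "homogeneous (\<Sum>i\<in>I. n i) (\<Prod>i\<in>I. f i)"
  using assms
proof (induction I rule: infinite_finite_induct)
  case (insert i I)
  then show ?case by (auto intro: homogeneous_times)
qed (use homogeneous_const[of "1 :: 'a"] in \<open>auto simp: const_poly_def\<close>)

lemma lin_subst_forms2: "f \<in> forms2 \<Longrightarrow> lin_subst A f \<in> forms2"
  unfolding forms2_iff lin_subst_def
proof (rule homogeneous_sum)
  fix m assume "homogeneous 2 f" "m \<in> Poly_Mapping.keys f"
  \<comment> \<open>The factor \<open>0 + 1\<close> mirrors the degrees of a constant and an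
    indeterminate, so that the introduction rules below produce exactly this sum.\<close>
  then have deg: "(\<Sum>i\<in>UNIV. Poly_Mapping.lookup m i * (0 + 1)) = 2"
    by (simp add: homogeneous_def)
  have prod: "homogeneous 2 (\<Prod>i\<in>UNIV.
      (\<Sum>j\<in>UNIV. const_poly (A $ i $ j) * indet j) ^ Poly_Mapping.lookup m i)"
    by (subst deg[symmetric]) (intro homogeneous_prod homogeneous_power homogeneous_sum
        homogeneous_times homogeneous_const homogeneous_indet)
  show "homogeneous 2 (const_poly (Poly_Mapping.lookup f m) *
      (\<Prod>i\<in>UNIV. (\<Sum>j\<in>UNIV. const_poly (A $ i $ j) * indet j) ^ Poly_Mapping.lookup m i))"
    using homogeneous_times[OF homogeneous_const prod] by (simp only: add_0)
qed

lemma forms2_add: "f \<in> forms2 \<Longrightarrow> g \<in> forms2 \<Longrightarrow> f + g \<in> forms2"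
  by (simp add: forms2_iff homogeneous_add)

lemma forms2_scale: "f \<in> forms2 \<Longrightarrow> const_poly (c :: 'a::comm_semiring_1) * f \<in> forms2"
  unfolding forms2_iff using homogeneous_times[OF homogeneous_const, of 2 f c] by (simp only: add_0)

section \<open>Monomials of degree 2\<close>

abbreviation mono2 :: "4 \<Rightarrow> 4 \<Rightarrow> (4 \<Rightarrow>\<^sub>0 nat)" where
  "mono2 i j \<equiv> Poly_Mapping.single i 1 + Poly_Mapping.single j 1"

lemma mono2_eq_iff: "mono2 i j = mono2 k l \<longleftrightarrow> i = k \<and> j = l \<or> i = l \<and> j = k"
proof
  assume "mono2 i j = mono2 k l"
  then have "Poly_Mapping.lookup (mono2 i j) n = Poly_Mapping.lookup (mono2 k l) n" for n by simp
  from this[of i] this[of j] show "i = k \<and> j = l \<or> i = l \<and> j = k"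
    by (auto simp: lookup_add lookup_single when_def split: if_splits)
qed (auto simp: add.commute)

lemma degree_Suc_split:
  fixes m :: "4 \<Rightarrow>\<^sub>0 nat"
  assumes "(\<Sum>i\<in>UNIV. Poly_Mapping.lookup m i) = Suc n"
  obtains i m' where "m = Poly_Mapping.single i 1 + m'" "(\<Sum>i\<in>UNIV. Poly_Mapping.lookup m' i) = n"
proof -
  obtain i where i: "Poly_Mapping.lookup m i \<noteq> 0"
    using assms by (metis nat.distinct(1) sum.neutral)
  have m: "m = Poly_Mapping.single i 1 + (m - Poly_Mapping.single i 1)"
    using i by (intro poly_mapping_eqI) (auto simp: lookup_add lookup_minus lookup_single when_def)
  have "(\<Sum>j\<in>UNIV. Poly_Mapping.lookup (Poly_Mapping.single i 1 + (m - Poly_Mapping.single i 1)) j) = Suc n"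
    using assms m by metis
  then have "(\<Sum>j\<in>UNIV. Poly_Mapping.lookup (m - Poly_Mapping.single i 1) j) = n"
    by (simp only: lookup_add sum.distrib) (simp add: lookup_single when_def)
  with m show ?thesis by (rule that)
qed

lemma degree_2_mono2:
  fixes m :: "4 \<Rightarrow>\<^sub>0 nat"
  assumes "(\<Sum>i\<in>UNIV. Poly_Mapping.lookup m i) = 2"
  obtains i j where "m = mono2 i j" "j \<le> i"
proof -
  obtain i n where n: "m = Poly_Mapping.single i 1 + n" "(\<Sum>i\<in>UNIV. Poly_Mapping.lookup n i) = Suc 0"
    using degree_Suc_split[of m "Suc 0"] assms by (metis numeral_2_eq_2)
  obtain j k where k: "n = Poly_Mapping.single j 1 + k" "(\<Sum>i\<in>UNIV. Poly_Mapping.lookup k i) = 0"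
    using degree_Suc_split[OF n(2)] by metis
  have "k = 0" using k(2) by (intro poly_mapping_eqI) simp
  then have "m = mono2 i j" "m = mono2 j i" using n k by (simp_all add: add.commute)
  then show ?thesis using that by (metis linear)
qed

lemma forms2_keys:
  assumes "f \<in> forms2" "m \<in> Poly_Mapping.keys f"
  obtains i j where "m = mono2 i j" "j \<le> i"
proof -
  have "(\<Sum>i\<in>UNIV. Poly_Mapping.lookup m i) = 2" using assms by (simp add: forms2_def)
  then show ?thesis by (rule degree_2_mono2) (rule that)
qed

lemma mono2_single_forms2: "Poly_Mapping.single (mono2 i j) c \<in> forms2"
  unfolding forms2_iff
  by (rule homogeneous_single) (simp add: lookup_add lookup_single when_def sum.distrib)

section \<open>Forms of degree 2 as quadratic forms\<close>

lemma quadratic_form_eval_poly: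
  assumes "f \<in> forms2" shows "quadratic_form (eval_poly f)"
proof -
  have "quadratic_form (\<lambda>x. \<Sum>m\<in>Poly_Mapping.keys f. Poly_Mapping.lookup f m * mono_eval m x)"
  proof (intro quadratic_form_sum quadratic_form_cmult)
    fix m assume "m \<in> Poly_Mapping.keys f"
    then obtain i j where "m = mono2 i j" using forms2_keys[OF assms] by metis
    then show "quadratic_form (mono_eval m)"
      using quadratic_form_times[OF linear_form_nth linear_form_nth, of i j]
      by (simp only: mono_eval_add mono_eval_single power_one_right)
  qed
  then show ?thesis by (simp add: eval_poly_def[abs_def])
qed

text \<open>At a unit vector every monomial of degree 2 except the square of that coordinate
  vanishes.\<close>

lemma lookup_forms2_diag:
  assumes "f \<in> forms2"
  shows "Poly_Mapping.lookup f (mono2 i i) = eval_poly f (axis i 1)"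
proof -
  have "eval_poly f (axis i 1) =
      (\<Sum>m\<in>Poly_Mapping.keys f. if m = mono2 i i then Poly_Mapping.lookup f m else 0)"
    unfolding eval_poly_def
  proof (rule sum.cong)
    fix m assume "m \<in> Poly_Mapping.keys f"
    then obtain k l where m: "m = mono2 k l" using forms2_keys[OF assms] by metis
    show "Poly_Mapping.lookup f m * mono_eval m (axis i 1) =
        (if m = mono2 i i then Poly_Mapping.lookup f m else 0)"
      unfolding m mono2_eq_iff mono_eval_add mono_eval_single by (auto simp: axis_def)
  qed simp
  then show ?thesis by (simp add: in_keys_iff)
qed

text \<open>Polarizing at two distinct unit vectors kills the squares and every mixed monomial but
  one. For \<open>i = j\<close> the result would be twice the coefficient.\<close>

lemma lookup_forms2_offdiag:
  assumes "f \<in> forms2" "i \<noteq> j"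
  shows "Poly_Mapping.lookup f (mono2 i j) = polar (eval_poly f) (axis i 1) (axis j 1)"
proof -
  have "polar (eval_poly f) (axis i 1) (axis j 1) =
      (\<Sum>m\<in>Poly_Mapping.keys f. Poly_Mapping.lookup f m * polar (mono_eval m) (axis i 1) (axis j 1))"
    by (simp add: polar_def eval_poly_def algebra_simps sum_subtractf sum.distrib)
  also have "\<dots> = (\<Sum>m\<in>Poly_Mapping.keys f. if m = mono2 i j then Poly_Mapping.lookup f m else 0)"
  proof (rule sum.cong)
    fix m assume "m \<in> Poly_Mapping.keys f"
    then obtain k l where m: "m = mono2 k l" using forms2_keys[OF assms(1)] by metis
    show "Poly_Mapping.lookup f m * polar (mono_eval m) (axis i 1) (axis j 1) =
        (if m = mono2 i j then Poly_Mapping.lookup f m else 0)"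
      unfolding m mono2_eq_iff polar_def mono_eval_add mono_eval_single
      using assms(2) by (auto simp: axis_def)
  qed simp
  finally show ?thesis by (simp add: in_keys_iff)
qed

text \<open>All coefficients are recovered from values at unit vectors and their sums, so this holds
  even over small finite fields, where functions do not determine polynomials in general.\<close>

lemma eval_poly_inj_forms2:
  fixes f g :: "'a::field poly4"
  assumes "f \<in> forms2" "g \<in> forms2" "eval_poly f = eval_poly g"
  shows "f = g"
proof (rule poly_mapping_eqI)
  fix m
  show "Poly_Mapping.lookup f m = Poly_Mapping.lookup g m"
  proof (cases "\<exists>i j. m = mono2 i j")
    case True
    then obtain i j where m: "m = mono2 i j" by blast
    show ?thesis
    proof (cases "i = j")
      case True
      then show ?thesis
        unfolding m using assms by (simp only: lookup_forms2_diag)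
    next
      case False
      then show ?thesis
        unfolding m lookup_forms2_offdiag[OF assms(1) False] lookup_forms2_offdiag[OF assms(2) False]
        by (simp only: assms(3))
    qed
  next
    case False
    then have "m \<notin> Poly_Mapping.keys f" "m \<notin> Poly_Mapping.keys g"
      using forms2_keys assms(1,2) by metis+
    then show ?thesis by (simp add: in_keys_iff)
  qed
qed

text \<open>Build up \<open>x\<close> from multiples of unit vectors one at a time; each new summand
  contributes only a diagonal value and polar values.\<close>

lemma quadratic_form_eq_0:
  assumes g: "quadratic_form g" and diag: "\<And>i. g (axis i 1) = 0"
    and offdiag: "\<And>i j. polar g (axis i 1) (axis j 1) = 0"
  shows "g x = 0"
proof -
  have polar0: "polar g (axis i 1) (\<Sum>j\<in>S. x $ j *s axis j 1) = 0" if "finite S" for i S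
    using that
  proof induction
    case empty
    then show ?case using linear_form_zero[OF quadratic_form_polar[OF g]] by simp
  qed (simp add: polar_add polar_scale g offdiag)
  have "g (\<Sum>j\<in>S. x $ j *s axis j 1) = 0" if "finite S" for S
    using that
  proof induction
    case (insert i S)
    then show ?case
      using polar0[of S i]
      by (simp add: quadratic_form_add quadratic_form_scale polar_scale_left g diag)
  qed (simp add: quadratic_form_zero g)
  from this[of UNIV] show ?thesis by (simp add: basis_expansion)
qed

section \<open>Forms with prescribed coefficients and the number of forms\<close>

definition form_of :: "(4 \<times> 4 \<Rightarrow> 'a::comm_semiring_1) \<Rightarrow> 'a poly4" where
  "form_of a = (\<Sum>(i, j)\<in>{(i, j). j \<le> i}. Poly_Mapping.single (mono2 i j) (a (i, j)))"

lemma form_of_forms2: "form_of a \<in> forms2"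
  unfolding form_of_def forms2_iff
  by (rule homogeneous_sum) (use mono2_single_forms2 in \<open>auto simp: forms2_iff\<close>)

lemma lookup_form_of:
  assumes "j \<le> i" shows "Poly_Mapping.lookup (form_of a) (mono2 i j) = a (i, j)"
proof -
  have "Poly_Mapping.lookup (form_of a) (mono2 i j) =
      (\<Sum>p\<in>{(i, j). j \<le> i}. if p = (i, j) then a p else 0)"
    unfolding form_of_def lookup_sum
  proof (rule sum.cong)
    fix p :: "4 \<times> 4" assume "p \<in> {(i, j). j \<le> i}"
    moreover obtain k l where "p = (k, l)" by (cases p)
    ultimately show "Poly_Mapping.lookup (case p of (i, j) \<Rightarrow> Poly_Mapping.single (mono2 i j) (a (i, j))) (mono2 i j) =
        (if p = (i, j) then a p else 0)"
      using assms by (simp only: prod.case lookup_single when_def mono2_eq_iff) auto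
  qed simp
  also have "\<dots> = a (i, j)" using assms by simp
  finally show ?thesis .
qed

lemma ex_forms2_eval:
  fixes h :: "'a::field ^ 4 \<Rightarrow> 'a"
  assumes h: "quadratic_form h"
  shows "\<exists>f\<in>forms2. eval_poly f = h"
proof -
  define f where
    "f = form_of (\<lambda>(i, j). if i = j then h (axis i 1) else polar h (axis i 1) (axis j 1))"
  have f: "f \<in> forms2" unfolding f_def by (rule form_of_forms2)
  have diag: "eval_poly f (axis i 1) = h (axis i 1)" for i
    unfolding lookup_forms2_diag[OF f, symmetric] unfolding f_def by (subst lookup_form_of) auto
  have "polar (eval_poly f) (axis i 1) (axis j 1) = polar h (axis i 1) (axis j 1)"
    if "j < i" for i j
    using that by (subst lookup_forms2_offdiag[OF f, symmetric])
      (simp, unfold f_def, subst lookup_form_of, auto)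
  \<comment> \<open>On the diagonal the polar form is twice the form, so it follows from
    \<open>diag\<close>.\<close>
  moreover have "polar (eval_poly f) (axis i 1) (axis i 1) = polar h (axis i 1) (axis i 1)" for i
    by (simp add: polar_self h quadratic_form_eval_poly[OF f] diag)
  ultimately have offdiag: "polar (eval_poly f) (axis i 1) (axis j 1) = polar h (axis i 1) (axis j 1)" for i j
    by (metis linorder_cases polar_commute)
  have g: "quadratic_form (\<lambda>x. eval_poly f x + (-1) * h x)"
    by (intro quadratic_form_plus quadratic_form_cmult h quadratic_form_eval_poly f)
  have "eval_poly f x = h x" for x
    using quadratic_form_eq_0[OF g, of x] diag offdiag by (simp add: polar_def)
  then show ?thesis using f by blast
qed

text \<open>Two triangles of equal size cover the 16 pairs and overlap in the 4 diagonal
  ones.\<close>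

lemma card_triangle_4: "card {(i, j). j \<le> (i :: 4)} = 10"
proof -
  let ?A = "{(i, j). j \<le> (i :: 4)}" and ?B = "{(i, j). i \<le> (j :: 4)}"
  have "card ?B = card ?A"
    by (rule bij_betw_same_card[of prod.swap]) (auto intro!: bij_betwI[where g = prod.swap])
  moreover have "?A \<union> ?B = UNIV" by auto
  moreover have "?A \<inter> ?B = (\<lambda>i. (i, i)) ` UNIV" by auto
  then have "card (?A \<inter> ?B) = 4" by (simp add: card_image inj_on_def)
  ultimately show ?thesis
    using card_Un_Int[of ?A ?B] by (simp flip: UNIV_Times_UNIV add: card_cartesian_product)
qed

lemma card_forms2: "card (forms2 :: 'a::{field,finite} poly4 set) = CARD('a) ^ 10"
proof -
  let ?I = "{(i, j). j \<le> (i :: 4)}"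
  \<comment> \<open>The restriction to \<open>?I\<close> makes the coefficient family extensional,
    as membership in the function space demands.\<close>
  let ?c = "\<lambda>f :: 'a poly4. \<lambda>(i, j)\<in>?I. Poly_Mapping.lookup f (mono2 i j)"
  have "card (forms2 :: 'a poly4 set) = card (?I \<rightarrow>\<^sub>E (UNIV :: 'a set))"
  proof (rule bij_betw_same_card[of ?c], rule bij_betwI[where g = form_of])
    fix f :: "'a poly4" assume f: "f \<in> forms2"
    show "form_of (?c f) = f"
    proof (rule poly_mapping_eqI)
      fix m
      show "Poly_Mapping.lookup (form_of (?c f)) m = Poly_Mapping.lookup f m"
      proof (cases "\<exists>i j. m = mono2 i j \<and> j \<le> i")
        case True
        then obtain i j where "m = mono2 i j" "j \<le> i" by blast
        then show ?thesis by (simp only: lookup_form_of) simp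
      next
        case False
        then have "m \<notin> Poly_Mapping.keys f" "m \<notin> Poly_Mapping.keys (form_of (?c f))"
          using forms2_keys f form_of_forms2 by metis+
        then show ?thesis by (simp add: in_keys_iff)
      qed
    qed
  next
    fix a assume "a \<in> ?I \<rightarrow>\<^sub>E (UNIV :: 'a set)"
    then show "?c (form_of a) = a"
      by (auto simp only: lookup_form_of fun_eq_iff restrict_apply split_beta mem_Collect_eq
          PiE_def extensional_def prod.collapse split: if_splits)
  qed (auto simp: form_of_forms2)
  then show ?thesis by (simp add: card_PiE card_triangle_4)
qed

section \<open>The rank and singular points\<close>

text \<open>A change of coordinates that moves a singular zero to a coordinate axis eliminates the
  corresponding indeterminate, so the rank would be at most 3.\<close>

lemma rank_4_nonsingular:
  fixes f :: "'a::field poly4"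
  assumes f: "f \<in> forms2" and rank: "form_rank f = 4"
    and p: "p \<noteq> 0" "eval_poly f p = 0"
  shows "\<exists>w. polar (eval_poly f) p w \<noteq> 0"
proof (rule ccontr)
  assume "\<not> ?thesis"
  then have sing: "polar (eval_poly f) p w = 0" for w by blast
  obtain k where k: "p $ k \<noteq> 0" using p(1) by (auto simp: vec_eq_iff)
  \<comment> \<open>The identity matrix with column \<open>k\<close> replaced by \<open>p\<close>;
    it is invertible because \<open>p $ k \<noteq> 0\<close>.\<close>
  define A :: "'a ^ 4 ^ 4" where "A = (\<chi> i j. if j = k then p $ i else if i = j then 1 else 0)"
  have A: "(A *v x) $ i = x $ k * p $ i + (if i = k then 0 else x $ i)" for x i
  proof -
    have "(A *v x) $ i = (\<Sum>j\<in>UNIV. (if j = k then p $ i else if i = j then 1 else 0) * x $ j)"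
      by (simp add: A_def matrix_vector_mult_def)
    also have "\<dots> = (\<Sum>j\<in>UNIV. (if j = k then x $ k * p $ i else 0) +
        (if j = i then if i = k then 0 else x $ i else 0))"
      by (rule sum.cong) auto
    finally show ?thesis by (simp add: sum.distrib)
  qed
  have "x = 0" if "A *v x = 0" for x
  proof -
    have *: "x $ k * p $ i + (if i = k then 0 else x $ i) = 0" for i
      using that A[of x i] by simp
    from *[of k] k have "x $ k = 0" by simp
    with * show ?thesis by (auto simp: vec_eq_iff split: if_splits) (metis add_0 mult_zero_left)
  qed
  then have inv: "invertible A"
    by (simp add: invertible_left_inverse matrix_left_invertible_ker)
  have Ak: "A *v axis k 1 = p"
    by (simp add: vec_eq_iff A) (simp add: axis_def)
  define g where "g = lin_subst A f"
  have g: "g \<in> forms2" unfolding g_def by (rule lin_subst_forms2[OF f])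
  have eval_g: "eval_poly g x = eval_poly f (A *v x)" for x
    by (simp add: g_def eval_poly_lin_subst)
  have diag: "eval_poly g (axis k 1) = 0" using p(2) by (simp add: eval_g Ak)
  have offdiag: "polar (eval_poly g) (axis k 1) y = 0" for y
    using sing[of "A *v y"] by (simp add: polar_def eval_g Ak matrix_vector_right_distrib)
  have lookup_k: "Poly_Mapping.lookup g (mono2 k j) = 0" for j
  proof (cases "k = j")
    case True
    then show ?thesis using diag by (simp only: lookup_forms2_diag[OF g])
  next
    case False
    show ?thesis unfolding lookup_forms2_offdiag[OF g False] by (rule offdiag)
  qed
  have "k \<notin> indets g"
  proof
    assume "k \<in> indets g"
    then obtain m where m: "m \<in> Poly_Mapping.keys g" "k \<in> Poly_Mapping.keys m"
      by (auto simp: indets_def)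
    from forms2_keys[OF g m(1)] obtain i j where ij: "m = mono2 i j" by metis
    then have "k = i \<or> k = j" using m(2) keys_add[of "Poly_Mapping.single i (1::nat)" "Poly_Mapping.single j 1"] by auto
    then have "\<exists>l. m = mono2 k l" using ij by (metis add.commute)
    then show False using lookup_k m(1) by (auto simp: in_keys_iff)
  qed
  then have "card (indets g) \<le> card (UNIV - {k})"
    by (intro card_mono) auto
  also have "\<dots> = 3" by (simp add: card_Diff_singleton)
  finally have "card (indets g) \<le> 3" .
  moreover have "finite {card (indets (lin_subst B f)) | B. invertible B}"
    by (rule finite_subset[of _ "{..4}"]) (use card_mono[of "UNIV :: 4 set"] in auto)
  then have "form_rank f \<le> card (indets g)"
    unfolding form_rank_def using inv by (intro Min_le) (auto simp: g_def)
  ultimately show False using rank by simp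
qed

section \<open>Projective counting\<close>

text \<open>Every nonzero vector is a nonzero multiple of exactly one normalized vector, with a
  unique factor.\<close>

lemma card_affine_cone:
  fixes P :: "'a::{field,finite} ^ 4 \<Rightarrow> bool"
  assumes P: "\<And>c v. c \<noteq> 0 \<Longrightarrow> P v \<Longrightarrow> P (c *s v)"
  shows "card {v. v \<noteq> 0 \<and> P v} = card {x \<in> proj_points. P x} * (CARD('a) - 1)"
proof -
  let ?f = "\<lambda>(x, c). c *s x :: 'a ^ 4"
  have nz: "x \<noteq> 0" if "x \<in> proj_points" for x :: "'a ^ 4"
    using that by (auto simp: proj_points_def)
  have "bij_betw ?f ({x \<in> proj_points. P x} \<times> (UNIV - {0})) {v. v \<noteq> 0 \<and> P v}"
  proof (rule bij_betw_imageI)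
    show "inj_on ?f ({x \<in> proj_points. P x} \<times> (UNIV - {0}))"
    proof -
      have "x = y \<and> c = d" if *: "x \<in> proj_points" "y \<in> proj_points" "c \<noteq> 0" "d \<noteq> 0" "c *s x = d *s y"
        for x y :: "'a ^ 4" and c d :: 'a
      proof -
        have "c *s x \<noteq> 0" using * nz by simp
        moreover have "x = inverse c *s (c *s x)" using *(3) by simp
        moreover have "y = inverse d *s (c *s x)" unfolding *(5) using *(4) by simp
        ultimately have "x = y"
          using proj_points_representatives[of "c *s x"] *(1-4)
          by (metis inverse_nonzero_iff_nonzero)
        then show ?thesis using * nz by auto
      qed
      then show ?thesis unfolding inj_on_def by auto
    qed
    show "?f ` ({x \<in> proj_points. P x} \<times> (UNIV - {0})) = {v. v \<noteq> 0 \<and> P v}"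
    proof (intro equalityI subsetI)
      fix v assume "v \<in> {v. v \<noteq> 0 \<and> P v}"
      then have v: "v \<noteq> 0" "P v" by auto
      obtain x c where x: "x \<in> proj_points" "c \<noteq> 0" "x = c *s v"
        using proj_points_representatives[OF v(1)] by blast
      then have "v = ?f (x, inverse c)" by (simp add: vec.scale_scale)
      moreover have "P x" unfolding x(3) by (rule P[OF x(2) v(2)])
      ultimately show "v \<in> ?f ` ({x \<in> proj_points. P x} \<times> (UNIV - {0}))"
        using x(1,2) by (intro image_eqI[of _ _ "(x, inverse c)"]) simp_all
    qed (auto simp: P nz)
  qed
  then show ?thesis
    by (simp add: bij_betw_same_card[symmetric] card_cartesian_product card_Diff_singleton)
qed

text \<open>Converts weights of codewords into affine counts: the zeros of \<open>Q\<close> outside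
  \<open>h\<close> form a cone with q - 1 vectors per point.\<close>

lemma (in elliptic_form) weight_common_zeros:
  assumes h: "quadratic_form h"
  shows "card {x \<in> proj_points. Q x = 0 \<and> h x \<noteq> 0} * (q - 1) +
    card {v. Q v = 0 \<and> h v = 0} + q\<^sup>2 = q ^ 3 + q"
proof -
  have "{v. Q v = 0} = {v. v \<noteq> 0 \<and> Q v = 0 \<and> h v \<noteq> 0} \<union> {v. Q v = 0 \<and> h v = 0}"
    using quadratic_form_zero[OF h] quadratic_form_zero[OF form] by auto
  moreover have "{v. v \<noteq> 0 \<and> Q v = 0 \<and> h v \<noteq> 0} \<inter> {v. Q v = 0 \<and> h v = 0} = {}" by auto
  ultimately have "card {v. Q v = 0} =
      card {v. v \<noteq> 0 \<and> Q v = 0 \<and> h v \<noteq> 0} + card {v. Q v = 0 \<and> h v = 0}"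
    by (simp add: card_Un_disjoint)
  moreover have "card {v. v \<noteq> 0 \<and> Q v = 0 \<and> h v \<noteq> 0} =
      card {x \<in> proj_points. Q x = 0 \<and> h x \<noteq> 0} * (q - 1)"
    using card_affine_cone[of "\<lambda>v. Q v = 0 \<and> h v \<noteq> 0"]
    by (simp add: quadratic_form_scale[OF form] quadratic_form_scale[OF h] card_field)
  ultimately show ?thesis using card_zeros by simp
qed

text \<open>The q^3 - q^2 + q zeros of \<open>Q\<close> minus the maximal 2 q^2 - 1 common zeros,
  counted as q - 1 vectors per point.\<close>

lemma (in elliptic_form) min_distance_factor:
  "(q\<^sup>2 - 2 * q - 1) * (q - 1) + 2 * q\<^sup>2 + q\<^sup>2 = q ^ 3 + q + 1"
proof -
  \<comment> \<open>Substituting 3 + k for q turns the truncated subtraction into a polynomial in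
    k.\<close>
  obtain k where k: "q = 3 + k" using q_ge_3 le_Suc_ex by blast
  then have "q\<^sup>2 - 2 * q - 1 = k * k + 4 * k + 2"
    by (simp add: power2_eq_square algebra_simps)
  then show ?thesis by (simp add: k power2_eq_square power3_eq_cube algebra_simps)
qed

lemma (in elliptic_form) min_distance_pos: "q\<^sup>2 - 2 * q - 1 > 0"
proof -
  obtain k where "q = 3 + k" using q_ge_3 le_Suc_ex by blast
  then show ?thesis by (simp add: power2_eq_square algebra_simps)
qed

lemma (in elliptic_form) weight_ge:
  assumes "quadratic_form h" and "\<And>c. \<exists>v. h v \<noteq> c * Q v"
  shows "q\<^sup>2 - 2 * q - 1 \<le> card {x \<in> proj_points. Q x = 0 \<and> h x \<noteq> 0}"
proof -
  have "(q\<^sup>2 - 2 * q - 1) * (q - 1) \<le> card {x \<in> proj_points. Q x = 0 \<and> h x \<noteq> 0} * (q - 1)"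
    using weight_common_zeros[OF assms(1)] card_common_zeros_le[OF assms] min_distance_factor
    by linarith
  then show ?thesis using q_ge_3 by simp
qed

lemma (in elliptic_form) exists_min_weight:
  obtains h where "quadratic_form h"
    "card {x \<in> proj_points. Q x = 0 \<and> h x \<noteq> 0} = q\<^sup>2 - 2 * q - 1"
proof -
  obtain h where h: "quadratic_form h" "card {v. Q v = 0 \<and> h v = 0} + 1 = 2 * q\<^sup>2"
    by (rule exists_max_common_zeros)
  have "card {x \<in> proj_points. Q x = 0 \<and> h x \<noteq> 0} * (q - 1) = (q\<^sup>2 - 2 * q - 1) * (q - 1)"
    using weight_common_zeros[OF h(1)] h(2) min_distance_factor by linarith
  then show ?thesis using that[OF h(1)] q_ge_3 by simp
qed

text \<open>Any other form would have weight at least q^2 - 2 q - 1 > 0. This determines the kernel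
  of the evaluation map.\<close>

lemma (in elliptic_form) vanishing_imp_multiple:
  assumes h: "quadratic_form h" and "\<And>x. x \<in> proj_points \<Longrightarrow> Q x = 0 \<Longrightarrow> h x = 0"
  obtains c where "\<And>v. h v = c * Q v"
proof -
  have "{x \<in> proj_points. Q x = 0 \<and> h x \<noteq> 0} = {}" using assms(2) by auto
  then have "card {x \<in> proj_points. Q x = 0 \<and> h x \<noteq> 0} = 0" by (simp only: card.empty)
  then show ?thesis using weight_ge[OF h] min_distance_pos that by (metis not_le)
qed

section \<open>Finite subspaces of words\<close>

text \<open>By induction: each new independent vector multiplies the size by the number of scalars,
  since its coefficient in a combination is unique.\<close>

lemma card_word_span:
  fixes B :: "('i \<Rightarrow> 'a::{field,finite}) set"
  assumes "finite B" "\<not> word.dependent B"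
  shows "card (word.span B) = CARD('a) ^ card B"
  using assms
proof (induction B)
  case (insert a B)
  have a: "a \<notin> word.span B" "\<not> word.dependent B"
    using insert.prems insert.hyps(2) by (auto simp: word.independent_insert)
  let ?f = "\<lambda>(k, x). scale_word k a + x"
  have "bij_betw ?f ((UNIV :: 'a set) \<times> word.span B) (word.span (insert a B))"
  proof (rule bij_betw_imageI)
    show "inj_on ?f (UNIV \<times> word.span B)"
    proof (rule inj_onI, clarsimp)
      fix k l :: 'a and x y
      assume *: "x \<in> word.span B" "y \<in> word.span B" "scale_word k a + x = scale_word l a + y"
      have "scale_word (k - l) a = y - x"
        using *(3) by (simp add: word.scale_left_diff_distrib algebra_simps)
      then have "scale_word (k - l) a \<in> word.span B"
        using *(1,2) by (simp add: word.span_diff)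
      then have "k = l"
        using a(1) word.span_scale[of "scale_word (k - l) a" B "inverse (k - l)"]
        by (cases "k = l") (auto simp: word.scale_scale)
      then show "k = l \<and> x = y" using *(3) by simp
    qed
    show "?f ` (UNIV \<times> word.span B) = word.span (insert a B)"
    proof (intro equalityI subsetI)
      fix x assume "x \<in> word.span (insert a B)"
      then obtain k where "x - scale_word k a \<in> word.span B"
        by (auto simp: word.span_insert)
      then show "x \<in> ?f ` (UNIV \<times> word.span B)"
        by (intro image_eqI[of _ _ "(k, x - scale_word k a)"]) auto
    next
      fix x assume "x \<in> ?f ` (UNIV \<times> word.span B)"
      then obtain k y where y: "y \<in> word.span B" "x = scale_word k a + y" by auto
      then have "x - scale_word k a \<in> word.span B" by simp
      then show "x \<in> word.span (insert a B)" by (auto simp: word.span_insert)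
    qed
  qed
  then show ?case
    using insert.IH[OF a(2)] insert.hyps
    by (simp add: bij_betw_same_card[symmetric] card_cartesian_product)
qed simp

lemma word_dim_eq:
  fixes C :: "('i \<Rightarrow> 'a::{field,finite}) set"
  assumes "word.subspace C" "card C = CARD('a) ^ k"
  shows "word.dim C = k"
proof -
  \<comment> \<open>Infinite sets have \<open>card\<close> 0, so the positive cardinality forces
    finiteness.\<close>
  have "finite C" using assms(2) by (intro card_ge_0_finite) simp
  obtain B where B: "B \<subseteq> C" "\<not> word.dependent B" "C \<subseteq> word.span B" "card B = word.dim C"
    using word.basis_exists by metis
  have "word.span B = C"
    using B assms(1) by (intro equalityI word.span_minimal) auto
  then have "CARD('a) ^ word.dim C = CARD('a) ^ k"
    using card_word_span[OF finite_subset[OF B(1) \<open>finite C\<close>] B(2)] B(4) assms(2) by simp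
  moreover have "1 < CARD('a)"
    using card_mono[of UNIV "{0, 1 :: 'a}"] by simp
  ultimately show ?thesis by (simp add: power_inject_exp)
qed

section \<open>The code of an elliptic quadric\<close>

lemma eval_word_add: "eval_word X (f + g) = eval_word X f + eval_word X g"
  by (auto simp: eval_word_def)

lemma eval_word_scale: "eval_word X (const_poly c * f) = scale_word c (eval_word X f)"
  by (auto simp: eval_word_def scale_word_def)

lemma subspace_functional_code2: "word.subspace (functional_code2 X)"
proof (rule word.subspaceI)
  show "0 \<in> functional_code2 X"
    unfolding functional_code2_def
    by (rule image_eqI[of _ _ 0]) (auto simp: eval_word_def forms2_def)
next
  fix u v assume "u \<in> functional_code2 X" "v \<in> functional_code2 X"
  then show "u + v \<in> functional_code2 X"
    unfolding functional_code2_def by (auto simp flip: eval_word_add intro: forms2_add)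
next
  fix c u assume "u \<in> functional_code2 X"
  then show "scale_word c u \<in> functional_code2 X"
    unfolding functional_code2_def by (auto simp flip: eval_word_scale intro: forms2_scale)
qed

lemma quadratic_form_eval_diff:
  "f \<in> forms2 \<Longrightarrow> g \<in> forms2 \<Longrightarrow> quadratic_form (\<lambda>v. eval_poly f v - eval_poly g v)"
  using quadratic_form_plus[OF quadratic_form_eval_poly quadratic_form_cmult[OF quadratic_form_eval_poly],
      of f g "-1"] by simp

theorem theorem6p7:
  fixes X :: "('a::{field,finite} ^ 4) set" and q :: nat
  assumes "CARD('a) = q"
    and "q \<ge> 3"
    and "elliptic_quadric X"
  shows "is_linear_code X (functional_code2 X) (q ^ 2 + 1) 9 (q ^ 2 - 2 * q - 1)"
proof -
  obtain F :: "'a poly4" where F: "F \<in> forms2" "F \<noteq> 0" "form_rank F = 4" and X: "X = zero_set F"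
    and cardX: "card X = q ^ 2 + 1"
    using assms by (auto simp: elliptic_quadric_def nondegenerate_quadric_def)
  let ?Q = "eval_poly F"
  have Q: "quadratic_form ?Q" by (rule quadratic_form_eval_poly[OF F(1)])
  interpret elliptic_form ?Q q
  proof
    \<comment> \<open>The affine zeros are the zero vector and q - 1 multiples of each of the q^2 +
      1 points.\<close>
    have "{v. ?Q v = 0} = insert 0 {v. v \<noteq> 0 \<and> ?Q v = 0}"
      using quadratic_form_zero[OF Q] by auto
    then have "card {v. ?Q v = 0} = Suc (card {v. v \<noteq> 0 \<and> ?Q v = 0})" by simp
    also have "card {v. v \<noteq> 0 \<and> ?Q v = 0} = (q ^ 2 + 1) * (q - 1)"
      using card_affine_cone[of "\<lambda>v. ?Q v = 0"] cardX assms(1)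
      by (simp add: quadratic_form_scale[OF Q] X zero_set_def)
    finally have "card {v. ?Q v = 0} = Suc ((q ^ 2 + 1) * (q - 1))" .
    moreover obtain k where "q = 3 + k" using assms(2) le_Suc_ex by blast
    ultimately show "card {v. ?Q v = 0} + q\<^sup>2 = q ^ 3 + q"
      by (simp add: power2_eq_square power3_eq_cube algebra_simps)
  qed (use Q rank_4_nonsingular[OF F(1,3)] assms in auto)
  let ?C = "functional_code2 X"
  have memX: "x \<in> X \<longleftrightarrow> x \<in> proj_points \<and> ?Q x = 0" for x
    by (simp add: X zero_set_def)

  \<comment> \<open>The fibres of the evaluation map are the cosets of the line spanned by
    \<open>F\<close>.\<close>
  have fibre: "{f \<in> forms2. eval_word X f = eval_word X g} = range (\<lambda>c. g + const_poly c * F)"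
    if g: "g \<in> forms2" for g
  proof (intro equalityI subsetI)
    fix f assume "f \<in> {f \<in> forms2. eval_word X f = eval_word X g}"
    then have f: "f \<in> forms2" "eval_word X f = eval_word X g" by auto
    have "eval_poly f x - eval_poly g x = 0" if "x \<in> proj_points" "?Q x = 0" for x
      using fun_cong[OF f(2), of x] that by (simp add: eval_word_def memX)
    then obtain c where "\<And>v. eval_poly f v - eval_poly g v = c * ?Q v"
      using vanishing_imp_multiple[OF quadratic_form_eval_diff[OF f(1) g]] by blast
    then have "eval_poly f = eval_poly (g + const_poly c * F)"
      by (auto simp: fun_eq_iff diff_eq_eq add.commute)
    then have "f = g + const_poly c * F"
      using eval_poly_inj_forms2 f(1) forms2_add[OF g forms2_scale[OF F(1)]] by blast
    then show "f \<in> range (\<lambda>c. g + const_poly c * F)" by blast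
  next
    fix f assume "f \<in> range (\<lambda>c. g + const_poly c * F)"
    then show "f \<in> {f \<in> forms2. eval_word X f = eval_word X g}"
      by (auto simp: forms2_add[OF g forms2_scale[OF F(1)]] eval_word_def memX)
  qed
  \<comment> \<open>A vector at which \<open>F\<close> is nonzero separates the elements of a coset,
    so each fibre has exactly q forms.\<close>
  obtain u where u: "?Q u \<noteq> 0"
  proof (rule ccontr)
    assume "\<not> thesis"
    then have "?Q = eval_poly 0" using that by (auto simp: fun_eq_iff)
    then have "F = 0" using F(1) by (intro eval_poly_inj_forms2) (auto simp: forms2_def)
    then show False using F(2) by simp
  qed
  have "inj (\<lambda>c. g + const_poly c * F)" for g
  proof (rule injI)
    fix c d assume "g + const_poly c * F = g + const_poly d * F"
    then have "eval_poly (g + const_poly c * F) u = eval_poly (g + const_poly d * F) u"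
      by (simp only:)
    then show "c = d" using u by simp
  qed
  then have card_fibre: "card {f \<in> forms2. eval_word X f = eval_word X g} = q"
    if "g \<in> forms2" for g
    unfolding fibre[OF that] by (simp add: card_image assms(1))
  have card_forms: "card (forms2 :: 'a poly4 set) = q ^ 10"
    by (simp add: card_forms2 assms(1))
  then have fin: "finite (forms2 :: 'a poly4 set)"
    using assms(2) by (intro card_ge_0_finite) simp
  \<comment> \<open>Counting the q^10 forms fibre by fibre gives q^9 codewords.\<close>
  have "card (forms2 :: 'a poly4 set) =
      (\<Sum>w\<in>?C. card {f \<in> forms2. eval_word X f = w})"
    unfolding functional_code2_def
    using sum.image_gen[OF fin, of "\<lambda>_. 1 :: nat" "eval_word X"] by simp
  also have "\<dots> = (\<Sum>w\<in>?C. q)"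
    by (rule sum.cong) (auto simp: functional_code2_def card_fibre)
  finally have "q * card ?C = q * q ^ 9"
    using card_forms power_Suc[of q 9] by (simp add: mult.commute)
  then have "card ?C = CARD('a) ^ 9" using assms(1,2) by simp
  then have dim: "word.dim ?C = 9" by (rule word_dim_eq[OF subspace_functional_code2])

  have dist: "hamming_dist X (eval_word X f) (eval_word X g) =
      card {x \<in> proj_points. ?Q x = 0 \<and> eval_poly f x - eval_poly g x \<noteq> 0}" for f g
    unfolding hamming_dist_def by (rule arg_cong[where f = card]) (auto simp: eval_word_def memX)
  have "min_distance X ?C = q\<^sup>2 - 2 * q - 1"
    unfolding min_distance_def
  proof (rule Min_eqI)
    have "finite ?C" using fin by (simp add: functional_code2_def)
    then have "finite ((\<lambda>(u, v). hamming_dist X u v) ` (?C \<times> ?C))" by simp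
    then show "finite {hamming_dist X u v | u v. u \<in> ?C \<and> v \<in> ?C \<and> u \<noteq> v}"
      by (rule rev_finite_subset) auto
  next
    fix n assume "n \<in> {hamming_dist X u v | u v. u \<in> ?C \<and> v \<in> ?C \<and> u \<noteq> v}"
    then obtain f g where fg: "f \<in> forms2" "g \<in> forms2" "eval_word X f \<noteq> eval_word X g"
      and n: "n = hamming_dist X (eval_word X f) (eval_word X g)"
      by (auto simp: functional_code2_def)
    \<comment> \<open>A multiple of \<open>F\<close> vanishes on \<open>X\<close>, so the two words
      would coincide.\<close>
    have "\<exists>v. eval_poly f v - eval_poly g v \<noteq> c * ?Q v" for c
    proof (rule ccontr)
      assume "\<not> ?thesis"
      then have "eval_word X f = eval_word X g"
        by (auto simp: eval_word_def memX fun_eq_iff) (metis eq_iff_diff_eq_0 mult_zero_right)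
      then show False using fg(3) by simp
    qed
    then show "q\<^sup>2 - 2 * q - 1 \<le> n"
      unfolding n dist by (intro weight_ge quadratic_form_eval_diff fg)
  next
    obtain h where h: "quadratic_form h"
      "card {x \<in> proj_points. ?Q x = 0 \<and> h x \<noteq> 0} = q\<^sup>2 - 2 * q - 1"
      by (rule exists_min_weight)
    obtain f where f: "f \<in> forms2" "eval_poly f = h" using ex_forms2_eval[OF h(1)] by blast
    have 0: "0 \<in> (forms2 :: 'a poly4 set)" by (simp add: forms2_def)
    have d: "hamming_dist X (eval_word X f) (eval_word X 0) = q\<^sup>2 - 2 * q - 1"
      unfolding dist using h(2) f(2) by simp
    have "hamming_dist X w w = 0" for w :: "'a ^ 4 \<Rightarrow> 'a" by (simp add: hamming_dist_def)
    \<comment> \<open>Positivity of q^2 - 2 q - 1 guarantees that the extremal form does not give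
      the zero word.\<close>
    then have "eval_word X f \<noteq> eval_word X 0" using d min_distance_pos by (metis less_irrefl)
    then show "q\<^sup>2 - 2 * q - 1 \<in> {hamming_dist X u v | u v. u \<in> ?C \<and> v \<in> ?C \<and> u \<noteq> v}"
      using d f(1) 0 by (auto simp: functional_code2_def) (metis imageI)
  qed
  then show ?thesis
    unfolding is_linear_code_def
    using cardX dim subspace_functional_code2[of X]
    by (auto simp: functional_code2_def words_def eval_word_def)
qed

end
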